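(* Let $3\leq m\leq n$, $\ell=m-1$, $p=(m-1)n$. Then $\overline{\mathfrak{S}}=\overline{\mathfrak{M}}=\overline{\mathfrak{C}}$ in $\mathbb{R}^{n\times n\times\ell}$ (Euclidean closures).
   Context: For $Y=(Y_1;\ldots;Y_\ell)\in\mathbb{R}^{n\times n\times\ell}$ and $\mathbf{a}=(a_1,\ldots,a_\ell,a_m)^\top\in\mathbb{R}^m$, $M(\mathbf{a},Y)=\sum_{k=1}^\ell a_kY_k-a_mE_n$. $\mathfrak{C}=\{Y\mid\det M(\mathbf a,Y)<0\text{ for some }\mathbf a\}$. $V(Y)=\{\mathbf{a}\in\mathbb{R}^n\mid \sum_{k=1}^\ell x_kY_k\mathbf{a}=x_m\mathbf{a}\text{ for some }(x_1,\ldots,x_m)^\top\neq\mathbf{0}\}$, $\hat V(Y)$ its linear span, $\mathfrak{S}=\{Y\mid\dim\hat V(Y)=n\}$. $\mathfrak{M}$ is the set of $Y$ for which there exist a real $m\times p$ matrix $(x_{ij})$ and a real $n\times p$ matrix $A=(\mathbf{a}_1,\ldots,\mathbf{a}_p)$ with $(x_{1j}Y_1+\cdots+x_{\ell j}Y_\ell-x_{mj}E_n)\mathbf{a}_j=\mathbf{0}$ for all $j$ and $\begin{pmatrix}AD_1\\ \vdots\\ AD_\ell\end{pmatrix}$ nonsingular, where $D_k=\operatorname{diag}(x_{k1},\ldots,x_{kp})$. *)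

theory Defs
  imports "HOL-Analysis.Analysis"
begin

text \<open>A tensor Y in R^{n x n x l} is a family (indexed by 'l) of n x n real matrices.
  The coefficient vector (a_1,...,a_l,a_m) is split as a vector in R^l plus the scalar a_m.\<close>

definition Mmat :: "real^'l \<Rightarrow> real \<Rightarrow> real^'n^'n^'l \<Rightarrow> real^'n^'n" where
  "Mmat a am Y = (\<Sum>k\<in>UNIV. (a $ k) *\<^sub>R (Y $ k)) - am *\<^sub>R mat 1"

definition Cset :: "(real^'n^'n^'l) set" where
  "Cset = {Y. \<exists>a am. det (Mmat a am Y) < 0}"

definition Vset :: "real^'n^'n^'l \<Rightarrow> (real^'n) set" where
  "Vset Y = {v. \<exists>x xm. (x \<noteq> 0 \<or> xm \<noteq> 0) \<and>
      (\<Sum>k\<in>UNIV. (x $ k) *\<^sub>R (Y $ k)) *v v = xm *\<^sub>R v}"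

definition Sset :: "(real^'n^'n^'l) set" where
  "Sset = {Y. dim (span (Vset Y)) = CARD('n)}"

text \<open>Columns are indexed by 'l \<times> 'n (p = l n). Column j carries coefficients
  (x j, xm j) and vector a j. The stacked matrix (A D_1; ...; A D_l) has row index (k,i)
  and entry a_j(i) * x_{kj}.\<close>

definition Mset :: "(real^'n^'n^'l) set" where
  "Mset = {Y. \<exists>(x :: 'l \<times> 'n \<Rightarrow> real^'l) (xm :: 'l \<times> 'n \<Rightarrow> real) (a :: 'l \<times> 'n \<Rightarrow> real^'n).
      (\<forall>j. Mmat (x j) (xm j) Y *v a j = 0) \<and>
      det ((\<chi> r j. (a j $ snd r) * (x j $ fst r)) :: real^('l \<times> 'n)^('l \<times> 'n)) \<noteq> 0}"

end

theory Submission
  imports Defs "HOL-Complex_Analysis.Complex_Singularities" "HOL-Computational_Algebra.Polynomial"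
begin

text \<open>Write \<open>Y(x) = \<Sum> x\<^sub>k Y\<^sub>k\<close>.  If \<open>Y\<close> lies in any of the three sets, then some \<open>Y(x)\<close> with
  \<open>x \<noteq> 0\<close> has a real eigenvector; conversely such a \<open>Y\<close> lies in the closure of
  \<open>Cset\<close> (perturb the singular matrix \<open>Y(x) - \<mu>\<close>) and, which is the main point, in
  the closure of \<open>Mset\<close>.

  \<open>Y\<close> belongs to \<open>Mset\<close> as soon as the tensors \<open>x \<otimes> a\<close>, with \<open>a\<close> an eigenvector of \<open>Y(x)\<close>, span.
  After a perturbation \<open>Y(x\<^sub>0)\<close> has a simple real eigenvalue \<open>\<mu>\<close>, with right and left eigenvectors
  \<open>v\<close>, \<open>l\<close> and reduced resolvent \<open>R\<close>.  Normalised by \<open>l \<bullet> a = 1\<close>, the nearby eigenvector \<open>a(t)\<close> of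
  \<open>Y(x\<^sub>0) + t C\<close>, \<open>C = Y\<^sub>k\<close>, solves the quadratic equation \<open>a = v + t R ((l \<bullet> C a) a - C a)\<close>.  Move
  \<open>(R, C)\<close> along a segment, with parameter \<open>s\<close>, towards a pair for which \<open>a(t)\<close> is a rational
  normal curve, so that the vectors \<open>(1, t) \<otimes> a(t)\<close> span.  For fixed small \<open>t\<close> the solution is
  holomorphic in \<open>s\<close> on a disc containing the whole segment, so a determinant witnessing the
  spanning property at \<open>s = 1\<close> is nonzero for all small \<open>s > 0\<close>.\<close>

section \<open>Matrices\<close>

lemma tendsto_in_closure:
  fixes l :: "'a::topological_space"
  assumes "(f \<longlongrightarrow> l) F" "eventually (\<lambda>x. f x \<in> S) F" "F \<noteq> bot"
  shows "l \<in> closure S"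
  by (rule Lim_in_closed_set[OF closed_closure eventually_mono[OF assms(2)] assms(3,1)])
     (use closure_subset in blast)

lemma tendsto_det:
  fixes A :: "'a \<Rightarrow> real^'n^'n"
  assumes "(A \<longlongrightarrow> B) F"
  shows "((\<lambda>x. det (A x)) \<longlongrightarrow> det B) F"
  unfolding det_def by (intro tendsto_intros assms)

lemma tendsto_matrix_mul:
  fixes A :: "'a \<Rightarrow> real^'n^'m" and C :: "'a \<Rightarrow> real^'p^'n"
  assumes "(A \<longlongrightarrow> B) F" "(C \<longlongrightarrow> D) F"
  shows "((\<lambda>x. A x ** C x) \<longlongrightarrow> B ** D) F"
  unfolding matrix_matrix_mult_def
  by (intro tendsto_vec_lambda tendsto_intros assms)

text \<open>Cramer's rule turns each entry of the inverse into a quotient of determinants, which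
  makes inversion continuous at nonsingular matrices.\<close>

lemma matrix_inv_cramer:
  fixes A :: "real^'n^'n"
  assumes "det A \<noteq> 0"
  shows "matrix_inv A $ k $ j = det (\<chi> p q. if q = k then axis j 1 $ p else A $ p $ q) / det A"
proof -
  have "invertible A" using assms invertible_det_nz by blast
  then have "A ** matrix_inv A = mat 1"
    unfolding matrix_inv_def invertible_def by (rule someI2_ex) blast
  then have "A *v (matrix_inv A *v axis j 1) = axis j 1"
    by (metis matrix_vector_mul_assoc matrix_vector_mul_lid)
  then have "matrix_inv A *v axis j 1 =
      (\<chi> k. det (\<chi> p q. if q = k then axis j 1 $ p else A $ p $ q) / det A)"
    using cramer[OF assms] by blast
  moreover have "(matrix_inv A *v axis j 1) $ k = matrix_inv A $ k $ j"
    by (simp add: matrix_vector_mult_basis column_def)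
  ultimately show ?thesis by simp
qed

lemma tendsto_matrix_inv:
  fixes A :: "'a \<Rightarrow> real^'n^'n"
  assumes "(A \<longlongrightarrow> B) F" "det B \<noteq> 0"
  shows "((\<lambda>x. matrix_inv (A x)) \<longlongrightarrow> matrix_inv B) F"
proof (intro vec_tendstoI)
  fix i j
  have "((\<lambda>x. det (\<chi> p q. if q = i then axis j 1 $ p else A x $ p $ q) / det (A x))
     \<longlongrightarrow> det (\<chi> p q. if q = i then axis j 1 $ p else B $ p $ q) / det B) F"
    by (intro tendsto_divide tendsto_det assms tendsto_vec_lambda)
       (auto intro!: tendsto_intros assms)
  moreover have "\<forall>\<^sub>F x in F. det (A x) \<noteq> 0"
    using tendsto_imp_eventually_ne[OF tendsto_det[OF assms(1)] assms(2)] .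
  then have "\<forall>\<^sub>F x in F. det (\<chi> p q. if q = i then axis j 1 $ p else A x $ p $ q) / det (A x)
       = matrix_inv (A x) $ i $ j"
    by eventually_elim (simp add: matrix_inv_cramer)
  ultimately show "((\<lambda>x. matrix_inv (A x) $ i $ j) \<longlongrightarrow> matrix_inv B $ i $ j) F"
    using assms(2) by (simp add: matrix_inv_cramer tendsto_cong)
qed

text \<open>A trivial annihilator means that \<open>S\<close> spans, so it contains a basis, whose
  members serve as columns. The hypothesis has this form because spanning is verified below by
  showing that linear relations are trivial.\<close>

lemma exists_det_nonzero:
  fixes S :: "(real^'m) set"
  assumes "\<And>c. (\<And>x. x \<in> S \<Longrightarrow> c \<bullet> x = 0) \<Longrightarrow> c = 0"
  obtains f where "\<And>j::'m. f j \<in> S" "det (\<chi> r j. f j $ r) \<noteq> 0"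
proof -
  have span: "span S = UNIV"
  proof (rule ccontr)
    assume "span S \<noteq> UNIV"
    then obtain c where "c \<noteq> 0" "span S \<subseteq> {x. c \<bullet> x = 0}"
      using span_not_univ_subset_hyperplane by metis
    then show False using assms[of c] span_base by blast
  qed
  obtain B where B: "B \<subseteq> S" "independent B" "S \<subseteq> span B" "card B = dim S"
    using basis_exists by metis
  have UB: "span B = UNIV" using span B span_mono by (metis span_span top.extremum_uniqueI)
  have "card B = CARD('m)" using B span by (metis dim_span dim_UNIV DIM_cart DIM_real mult.right_neutral)
  then obtain f where f: "bij_betw f (UNIV::'m set) B"
    using finite_same_card_bij[of "UNIV::'m set" B] B(2) independent_bound by auto
  have "\<exists>G. G ** (\<chi> j. f j) = mat 1"
    unfolding matrix_left_invertible_ker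
  proof (intro allI impI)
    fix c assume "(\<chi> j. f j) *v c = 0"
    then have *: "f j \<bullet> c = 0" for j
      by (metis matrix_vector_mul_component vec_lambda_beta zero_index)
    have "c \<bullet> x = 0" if "x \<in> B" for x
      using that f * by (metis bij_betw_imp_surj_on imageE inner_commute)
    then have "c \<bullet> x = 0" if "x \<in> span B" for x
      using orthogonal_to_span[of x B c] that unfolding orthogonal_def by auto
    then show "c = 0" using UB by (metis UNIV_I inner_eq_zero_iff)
  qed
  then have "invertible (\<chi> j. f j)" by (simp add: invertible_left_inverse)
  then have "det (\<chi> j. f j) \<noteq> 0" using invertible_det_nz by blast
  then have "det (transpose (\<chi> j. f j)) \<noteq> 0" by simp
  moreover have "transpose (\<chi> j. f j) = (\<chi> r j. f j $ r)" by (simp add: transpose_def)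
  ultimately show thesis using that f B(1) by (metis UNIV_I bij_betwE subsetD)
qed

section \<open>Determinants depending on a parameter\<close>

lemma holomorphic_on_det:
  assumes "\<And>i j. (\<lambda>s. M s $ i $ j) holomorphic_on S"
  shows "(\<lambda>s. det (M s :: complex^'m^'m)) holomorphic_on S"
  unfolding det_def by (intro holomorphic_intros assms)

lemma det_of_real:
  fixes A :: "real^'m^'m"
  shows "det (\<chi> i j. complex_of_real (A $ i $ j)) = of_real (det A)"
  unfolding det_def by simp

text \<open>The determinant of \<open>M s\<close> is holomorphic on the connected set
  \<open>S\<close> and nonzero at \<open>r0\<close>, so its zeros are isolated. It may vanish at 0
  itself, but not at small positive reals.\<close>

lemma eventually_det_neq_0:
  fixes A :: "real \<Rightarrow> real^'m^'m"
    and M :: "complex \<Rightarrow> 'm \<Rightarrow> 'm \<Rightarrow> complex"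
  assumes "\<And>i j. (\<lambda>s. M s i j) holomorphic_on S" "open S" "connected S" "0 \<in> S"
    and real: "\<And>r i j. of_real r \<in> S \<Longrightarrow> M (of_real r) i j = of_real (A r $ i $ j)"
    and "of_real r0 \<in> S" "det (A r0) \<noteq> 0"
  shows "\<forall>\<^sub>F r in at_right 0. det (A r) \<noteq> 0"
proof -
  let ?D = "\<lambda>s. det (\<chi> i j. M s i j)"
  have D: "?D (of_real r) = of_real (det (A r))" if "of_real r \<in> S" for r
    using that by (simp add: real det_of_real)
  have "?D holomorphic_on S"
    by (rule holomorphic_on_det) (use assms(1) in simp)
  then have "\<forall>\<^sub>F s in at 0. ?D s \<noteq> 0 \<and> s \<in> S"
    by (rule non_zero_neighbour_alt[OF _ assms(2,3,4,6)]) (metis D assms(6,7) of_real_eq_0_iff)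
  moreover have "filterlim complex_of_real (at 0) (at_right 0)"
    unfolding filterlim_at by (auto simp: eventually_at_filter intro!: tendsto_eq_intros)
  ultimately have "\<forall>\<^sub>F r in at_right 0. ?D (of_real r) \<noteq> 0 \<and> of_real r \<in> S"
    by (rule eventually_compose_filterlim)
  then show ?thesis by eventually_elim (use D in force)
qed

lemma eventually_det_line_neq_0:
  fixes A B :: "real^'m^'m"
  assumes "det (A + r0 *\<^sub>R B) \<noteq> 0"
  shows "\<forall>\<^sub>F r in at_right 0. det (A + r *\<^sub>R B) \<noteq> 0"
  by (rule eventually_det_neq_0[where S = UNIV and ?r0.0 = r0
        and M = "\<lambda>s i j. of_real (A $ i $ j) + s * of_real (B $ i $ j)"])
     (auto intro!: holomorphic_intros assms)

lemma det_scaleR: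
  fixes A :: "real^'n^'n"
  shows "det (c *\<^sub>R A) = c ^ CARD('n) * det A"
proof -
  have "c *\<^sub>R A = (\<chi> i. c *s A $ i)" by (simp add: vec_eq_iff)
  then show ?thesis using det_rows_mul[of "\<lambda>_. c" "\<lambda>i. A $ i"] by simp
qed

text \<open>For \<rho> = 1/r the matrix A + \<rho> is 1/r times 1 + r A, and the determinant of the
  latter tends to 1 as r tends to 0.\<close>

lemma det_shift_pos:
  fixes A :: "real^'n^'n"
  obtains \<rho> where "\<rho> > K" "det (A + \<rho> *\<^sub>R mat 1) > 0"
proof -
  have "((\<lambda>r. det (mat 1 + r *\<^sub>R A)) \<longlongrightarrow> det (mat 1 + 0 *\<^sub>R A)) (at_right 0)"
    by (intro tendsto_det tendsto_intros)
  then have "\<forall>\<^sub>F r in at_right 0. det (mat 1 + r *\<^sub>R A) > 0"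
    by (rule order_tendstoD) simp
  moreover have "\<forall>\<^sub>F r in at_right 0. 0 < r \<and> r < 1 / (\<bar>K\<bar> + 1)"
    by (auto simp: eventually_at_right_field intro!: exI[of _ "1 / (\<bar>K\<bar> + 1)"])
  ultimately have "\<forall>\<^sub>F r in at_right 0. det (mat 1 + r *\<^sub>R A) > 0 \<and> 0 < r \<and> r < 1 / (\<bar>K\<bar> + 1)"
    by (rule eventually_conj)
  then obtain r where r: "det (mat 1 + r *\<^sub>R A) > 0" "0 < r" "r < 1 / (\<bar>K\<bar> + 1)"
    using eventually_happens trivial_limit_at_right_real by (metis (no_types, lifting))
  have "A + (1/r) *\<^sub>R mat 1 = (1/r) *\<^sub>R (mat 1 + r *\<^sub>R A)"
    using r(2) by (simp add: scaleR_add_right)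
  then have "det (A + (1/r) *\<^sub>R mat 1) > 0"
    using r by (simp add: det_scaleR)
  moreover have "\<bar>K\<bar> + 1 < 1 / r" using r by (simp add: field_simps)
  ultimately show thesis using that[of "1/r"] by linarith
qed

section \<open>Perturbing a singular matrix\<close>

definition outer :: "real^'m \<Rightarrow> real^'n \<Rightarrow> real^'n^'m"
  where "outer v l = (\<chi> i j. v $ i * l $ j)"

lemma outer_mult [simp]: "outer v l *v x = (l \<bullet> x) *\<^sub>R v"
  by (simp add: outer_def matrix_vector_mult_def vec_eq_iff inner_vec_def sum_distrib_left
      sum_distrib_right mult_ac)

text \<open>The reflection \<open>F\<close> in the hyperplane orthogonal to the kernel vector has
  determinant -1 and satisfies \<open>N ** F = N\<close>. Hence \<open>G \<epsilon>\<close> and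
  \<open>G \<epsilon> ** F\<close> both tend to \<open>N\<close>, and one of them has negative
  determinant whenever \<open>G \<epsilon>\<close> is nonsingular.\<close>

lemma singular_in_closure_det_neg:
  fixes N :: "real^'n^'n"
  assumes "N *v v = 0" "v \<noteq> 0"
  shows "N \<in> closure {W. det W < 0}"
proof -
  obtain i0 :: 'n where True by blast
  define u where "u = v /\<^sub>R norm v"
  have u: "norm u = 1" "N *v u = 0"
    using assms by (auto simp: u_def matrix_vector_mult_scaleR)
  obtain P where P: "orthogonal_matrix P" "P *v axis i0 1 = u"
    using orthogonal_matrix_exists_basis[OF u(1)] by blast
  \<comment> \<open>\<open>D\<close> reverses the axis that \<open>P\<close> sends to
    \<open>u\<close>; its conjugate \<open>F\<close> therefore changes a vector only along
    \<open>u\<close>, that is, inside the kernel of \<open>N\<close>.\<close>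
  define D :: "real^'n^'n" where "D = (\<chi> i j. if i = j then (if i = i0 then -1 else 1) else 0)"
  have detD: "det D = -1"
    by (subst det_diagonal) (auto simp: D_def prod.If_cases)
  define Q where "Q = transpose P"
  define F where "F = P ** D ** Q"
  have "det P * det P = 1" using det_orthogonal_matrix[OF P(1)] by auto
  then have detF: "det F = -1" by (simp add: F_def Q_def det_mul detD)
  have Dx: "D *v x = x - (2 * x $ i0) *\<^sub>R axis i0 1" for x
    by (simp add: vec_eq_iff D_def matrix_vector_mult_def axis_def if_distrib[of "\<lambda>a. a * _"]
        sum.If_cases cong: if_cong)
  have PQ: "P *v (Q *v x) = x" for x
    using P(1) by (simp add: orthogonal_matrix_def Q_def matrix_vector_mul_assoc del: transpose_matrix_vector)
  have Fx: "\<exists>c. F *v x = x - c *\<^sub>R u" for x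
  proof -
    have "F *v x = P *v (D *v (Q *v x))"
      by (simp add: F_def flip: matrix_vector_mul_assoc)
    also have "\<dots> = x - (2 * (Q *v x) $ i0) *\<^sub>R u"
      by (simp add: Dx matrix_vector_mult_diff_distrib matrix_vector_mult_scaleR P PQ)
    finally show ?thesis by blast
  qed
  have NF: "N ** F = N"
    unfolding matrix_eq
  proof
    fix x
    obtain c where "F *v x = x - c *\<^sub>R u" using Fx by blast
    then show "(N ** F) *v x = N *v x"
      by (simp add: matrix_vector_mult_diff_distrib matrix_vector_mult_scaleR u
          flip: matrix_vector_mul_assoc)
  qed
  define G where "G \<epsilon> = N + \<epsilon> *\<^sub>R mat 1" for \<epsilon> :: real
  define W where "W \<epsilon> = (if det (G \<epsilon>) < 0 then G \<epsilon> else G \<epsilon> ** F)" for \<epsilon>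
  have G: "(G \<longlongrightarrow> N) (at_right 0)"
    unfolding G_def by (auto intro!: tendsto_eq_intros)
  have lim: "(W \<longlongrightarrow> N) (at_right 0)"
  proof (rule topological_tendstoI)
    fix S assume S: "open S" "N \<in> S"
    have "((\<lambda>\<epsilon>. G \<epsilon> ** F) \<longlongrightarrow> N) (at_right 0)"
      using tendsto_matrix_mul[OF G tendsto_const, of F] by (simp add: NF)
    then have "\<forall>\<^sub>F \<epsilon> in at_right 0. G \<epsilon> ** F \<in> S" using S by (rule topological_tendstoD)
    moreover have "\<forall>\<^sub>F \<epsilon> in at_right 0. G \<epsilon> \<in> S" using G S by (rule topological_tendstoD)
    ultimately show "\<forall>\<^sub>F \<epsilon> in at_right 0. W \<epsilon> \<in> S"
      by eventually_elim (simp add: W_def)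
  qed
  obtain r0 where "det (G r0) \<noteq> 0"
    using det_shift_pos[of 0 N] unfolding G_def by (metis less_irrefl)
  then have "\<forall>\<^sub>F r in at_right 0. det (G r) \<noteq> 0"
    unfolding G_def by (rule eventually_det_line_neq_0)
  then have "\<forall>\<^sub>F r in at_right 0. W r \<in> {W. det W < 0}"
    by eventually_elim (auto simp: W_def det_mul detF)
  then show ?thesis using tendsto_in_closure[OF lim] by (simp add: trivial_limit_at_right_real)
qed

lemma det_neq_0_kernelI:
  fixes A :: "real^'n^'n"
  assumes "\<And>x. A *v x = 0 \<Longrightarrow> x = 0"
  shows "det A \<noteq> 0"
  using assms matrix_left_invertible_ker invertible_left_inverse invertible_det_nz by blast

lemma matrix_inv_inverse:
  fixes A :: "real^'n^'n"
  assumes "det A \<noteq> 0"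
  shows "matrix_inv A *v (A *v x) = x" "A *v (matrix_inv A *v x) = x"
proof -
  have "invertible A" using assms invertible_det_nz by blast
  then have "A ** matrix_inv A = mat 1 \<and> matrix_inv A ** A = mat 1"
    unfolding matrix_inv_def invertible_def by (rule someI_ex)
  then show "matrix_inv A *v (A *v x) = x" "A *v (matrix_inv A *v x) = x"
    by (simp_all add: matrix_vector_mul_assoc)
qed

lemma scaleR_mat_mult: "((c *\<^sub>R A) *v x) = c *\<^sub>R ((A :: real^'n^'m) *v x)"
  by (simp add: scaleR_matrix_vector_assoc)

text \<open>The conditions force 0 to be a simple eigenvalue of \<open>N\<close> with right
  eigenvector \<open>v\<close> and left eigenvector \<open>l\<close>; then \<open>R\<close> is the
  inverse of \<open>N\<close> on the kernel of \<open>l\<close>, extended by 0 on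
  \<open>v\<close>.\<close>

definition reduced_resolvent :: "real^'n^'n \<Rightarrow> real^'n \<Rightarrow> real^'n \<Rightarrow> real^'n^'n \<Rightarrow> bool"
  where "reduced_resolvent N v l R \<longleftrightarrow> N *v v = 0 \<and> l \<bullet> v = 1 \<and> R *v v = 0 \<and>
    (\<forall>x. l \<bullet> (R *v x) = 0) \<and> (\<forall>x. N *v (R *v x) = x - (l \<bullet> x) *\<^sub>R v)"

text \<open>Adding a multiple of the projection orthogonal to \<open>v\<close> keeps
  \<open>v\<close> in the kernel, while for small \<open>r > 0\<close> it makes \<open>K r\<close>,
  which is \<open>N' r\<close> plus the projection onto \<open>v\<close>, invertible. The inverse of
  \<open>K r\<close> then yields both \<open>l\<close> and \<open>R\<close>.\<close>

lemma singular_in_closure_reduced_resolvent: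
  fixes N :: "real^'n^'n"
  assumes "N *v v = 0" "norm v = 1"
  shows "N \<in> closure {N'. \<exists>l R. reduced_resolvent N' v l R}"
proof -
  have vv: "v \<bullet> v = 1" using assms(2) by (simp add: norm_eq_1)
  define N' where "N' r = N + r *\<^sub>R (mat 1 - outer v v)" for r
  have N'v: "N' r *v v = 0" for r
    by (simp add: N'_def algebra_simps matrix_vector_mult_add_rdistrib
        matrix_vector_mult_diff_rdistrib scaleR_mat_mult assms vv)
  define K where "K r = (N + outer v v) + r *\<^sub>R (mat 1 - outer v v)" for r
  have K: "K r *v x = N' r *v x + (v \<bullet> x) *\<^sub>R v" for r x
    by (simp add: K_def N'_def matrix_vector_mult_add_rdistrib)
  obtain r0 where r0: "r0 > 0" "det (N + r0 *\<^sub>R mat 1) > 0"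
    using det_shift_pos by metis
  have "det (K r0) \<noteq> 0"
  proof (rule det_neq_0_kernelI)
    fix x assume x: "K r0 *v x = 0"
    \<comment> \<open>Chosen so that \<open>N + r0 *\<^sub>R mat 1\<close> sends
      \<open>x + c *\<^sub>R v\<close> to \<open>K r0 *v x\<close>. The kernel of
      \<open>K r0\<close> thus lies on the line of \<open>v\<close>, where \<open>K r0\<close> is
      the identity.\<close>
    define c where "c = (1 - r0) / r0 * (v \<bullet> x)"
    have "(N + r0 *\<^sub>R mat 1) *v (x + c *\<^sub>R v) = K r0 *v x"
    proof -
      have "c * r0 = (1 - r0) * (v \<bullet> x)" using r0 by (simp add: c_def)
      then have "(N + r0 *\<^sub>R mat 1) *v (x + c *\<^sub>R v) = N *v x + r0 *\<^sub>R x + ((1 - r0) * (v \<bullet> x)) *\<^sub>R v"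
        by (simp add: matrix_vector_mult_add_rdistrib matrix_vector_right_distrib
            scaleR_mat_mult assms matrix_vector_mult_scaleR scaleR_add_right)
      then show ?thesis
        by (simp add: K N'_def algebra_simps matrix_vector_mult_add_rdistrib
          matrix_vector_mult_diff_rdistrib scaleR_mat_mult)
    qed
    then have "x + c *\<^sub>R v = 0"
      using x matrix_inv_inverse(1)[of "N + r0 *\<^sub>R mat 1" "x + c *\<^sub>R v"] r0 by simp
    then have "x = (-c) *\<^sub>R v" by (simp add: eq_neg_iff_add_eq_0)
    moreover have "K r0 *v v = v" by (simp add: K N'v vv)
    then have "K r0 *v ((-c) *\<^sub>R v) = (-c) *\<^sub>R v" by (simp only: matrix_vector_mult_scaleR)
    ultimately show "x = 0" using x by metis
  qed
  then have "\<forall>\<^sub>F r in at_right 0. det (K r) \<noteq> 0"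
    unfolding K_def by (rule eventually_det_line_neq_0)
  then have "\<forall>\<^sub>F r in at_right 0. N' r \<in> {N'. \<exists>l R. reduced_resolvent N' v l R}"
  proof eventually_elim
    case (elim r)
    define W where "W = matrix_inv (K r)"
    note W = matrix_inv_inverse[OF elim, folded W_def]
    \<comment> \<open>This is the functional that makes \<open>K r *v (W *v x) = x\<close> read as
      \<open>N' r *v (W *v x) = x - (l \<bullet> x) *\<^sub>R v\<close>.\<close>
    define l where "l = transpose W *v v"
    have l: "l \<bullet> x = v \<bullet> (W *v x)" for x
      by (simp add: l_def dot_lmul_matrix[symmetric])
    have Wv: "W *v v = v" using W(1)[of v] by (simp add: K N'v vv)
    define Q where "Q = mat 1 - outer v l"
    have Q: "Q *v x = x - (l \<bullet> x) *\<^sub>R v" for x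
      by (simp add: Q_def matrix_vector_mult_diff_rdistrib)
    have lv: "l \<bullet> v = 1" by (simp add: l Wv vv)
    have lQ: "l \<bullet> (Q *v x) = 0" for x by (simp add: Q inner_diff_right lv)
    have N'W: "N' r *v (W *v x) = x - (l \<bullet> x) *\<^sub>R v" for x
      using W(2)[of x] K[of r "W *v x"] by (simp add: l algebra_simps)
    \<comment> \<open>The right factor \<open>Q\<close> kills \<open>v\<close> and the left one puts
      the range into the kernel of \<open>l\<close>; since \<open>N' r\<close> kills
      \<open>v\<close>, the left factor does not disturb the equation for
      \<open>N' r\<close>.\<close>
    define R where "R = Q ** W ** Q"
    have R: "R *v x = Q *v (W *v (Q *v x))" for x
      by (simp add: R_def flip: matrix_vector_mul_assoc)
    have Qv: "Q *v v = 0" by (simp add: Q lv)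
    have "reduced_resolvent (N' r) v l R"
      unfolding reduced_resolvent_def
    proof (intro conjI allI)
      show "N' r *v v = 0" by (rule N'v)
      show "l \<bullet> v = 1" by (rule lv)
      show "R *v v = 0" by (simp add: R Qv)
      show "l \<bullet> (R *v x) = 0" for x by (simp add: R lQ)
      fix x
      have "N' r *v (R *v x) = N' r *v (W *v (Q *v x))"
        by (simp add: R Q[of "W *v (Q *v x)"] matrix_vector_mult_diff_distrib
            matrix_vector_mult_scaleR N'v)
      also have "\<dots> = x - (l \<bullet> x) *\<^sub>R v" by (simp add: N'W lQ) (simp add: Q)
      finally show "N' r *v (R *v x) = x - (l \<bullet> x) *\<^sub>R v" .
    qed
    then show ?case by blast
  qed
  moreover have "(N' \<longlongrightarrow> N) (at_right 0)"
    unfolding N'_def by (auto intro!: tendsto_eq_intros)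
  ultimately show ?thesis
    by (intro tendsto_in_closure) (auto simp: trivial_limit_at_right_real)
qed

section \<open>Pencils\<close>

definition pencil :: "real^'l \<Rightarrow> real^'n^'n^'l \<Rightarrow> real^'n^'n"
  where "pencil x Y = (\<Sum>k\<in>UNIV. x $ k *\<^sub>R Y $ k)"

lemma Mmat_pencil: "Mmat x c Y = pencil x Y - c *\<^sub>R mat 1"
  by (simp add: Mmat_def pencil_def)

lemma Mmat_mult_eq_0_iff: "Mmat x c Y *v a = 0 \<longleftrightarrow> pencil x Y *v a = c *\<^sub>R a"
  by (simp add: Mmat_pencil matrix_vector_mult_diff_rdistrib scaleR_mat_mult)

text \<open>The columns of the stacked matrix are the tensors of \<open>x\<close> with
  \<open>a\<close>, read as vectors indexed by pairs. If only \<open>c = 0\<close> annihilates all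
  such tensors, they span, and a basis can be selected among them.\<close>

lemma Mset_criterion:
  fixes Y :: "real^'n^'n^'l"
  assumes "\<And>c :: real^'n^'l.
    (\<And>x a \<mu>. pencil x Y *v a = \<mu> *\<^sub>R a \<Longrightarrow> (\<Sum>k\<in>UNIV. x $ k *\<^sub>R c $ k) \<bullet> a = 0) \<Longrightarrow> c = 0"
  shows "Y \<in> Mset"
proof -
  let ?z = "\<lambda>x a. (\<chi> r. a $ snd r * x $ fst r) :: real^('l \<times> 'n)"
  let ?S = "{?z x a | x a. \<exists>\<mu>. pencil x Y *v a = \<mu> *\<^sub>R a}"
  have zero: "c = 0" if "\<And>z. z \<in> ?S \<Longrightarrow> c \<bullet> z = 0" for c
  proof -
    let ?c = "(\<chi> k i. c $ (k, i)) :: real^'n^'l"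
    have "(\<Sum>k\<in>UNIV. x $ k *\<^sub>R ?c $ k) \<bullet> a = c \<bullet> ?z x a" for x a
    proof -
      have "c \<bullet> ?z x a = (\<Sum>(k, i)\<in>UNIV \<times> UNIV. c $ (k, i) * (a $ i * x $ k))"
        by (simp add: inner_vec_def case_prod_unfold)
      also have "\<dots> = (\<Sum>k\<in>UNIV. \<Sum>i\<in>UNIV. c $ (k, i) * (a $ i * x $ k))"
        by (rule sum.cartesian_product[symmetric])
      also have "\<dots> = (\<Sum>k\<in>UNIV. x $ k *\<^sub>R ?c $ k) \<bullet> a"
        unfolding inner_sum_left inner_scaleR_left
        by (simp add: inner_vec_def sum_distrib_left mult_ac)
      finally show ?thesis by simp
    qed
    moreover have "c \<bullet> ?z x a = 0" if "pencil x Y *v a = \<mu> *\<^sub>R a" for x a \<mu>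
      by (rule \<open>\<And>z. z \<in> ?S \<Longrightarrow> c \<bullet> z = 0\<close>) (use that in blast)
    ultimately have "?c = 0" by (intro assms) metis
    then show ?thesis by (simp add: vec_eq_iff split_paired_all)
  qed
  obtain f where f: "\<And>j. f j \<in> ?S" "det (\<chi> r j. f j $ r) \<noteq> 0"
  proof (rule exists_det_nonzero)
    show "c = 0" if "\<And>z. z \<in> ?S \<Longrightarrow> c \<bullet> z = 0" for c
      using that by (rule zero)
  next
    fix f :: "'l \<times> 'n \<Rightarrow> real^('l \<times> 'n)"
    assume "\<And>j. f j \<in> ?S" "det (\<chi> r j. f j $ r) \<noteq> 0"
    then show thesis by (rule that[of f])
  qed
  define P where "P j x a c \<longleftrightarrow> f j = ?z x a \<and> pencil x Y *v a = c *\<^sub>R a" for j x a c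
  have "\<exists>x a c. P j x a c" for j using f(1)[of j] unfolding P_def by blast
  then obtain x a c where "\<And>j. P j (x j) (a j) (c j)" by metis
  then have *: "\<And>j. f j = ?z (x j) (a j)" "\<And>j. pencil (x j) Y *v a j = c j *\<^sub>R a j"
    unfolding P_def by blast+
  have "(\<chi> r j. f j $ r) = (\<chi> r j. a j $ snd r * x j $ fst r)"
    by (simp add: * vec_eq_iff)
  then show ?thesis
    unfolding Mset_def Mmat_mult_eq_0_iff using f(2) *(2) by auto
qed

text \<open>Corrects the single slice \<open>k0\<close> so that the pencil at \<open>x\<close> takes
  the value \<open>W\<close>; this needs a nonzero coordinate \<open>x $ k0\<close>. All other
  slices remain at free disposal.\<close>

definition adjust :: "'l \<Rightarrow> real^'l \<Rightarrow> real^'n^'n^'l \<Rightarrow> real^'n^'n \<Rightarrow> real^'n^'n^'l"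
  where "adjust k0 x Y W = (\<chi> k. if k = k0 then Y $ k + (1 / x $ k0) *\<^sub>R (W - pencil x Y) else Y $ k)"

lemma adjust_nth: "k \<noteq> k0 \<Longrightarrow> adjust k0 x Y W $ k = Y $ k"
  by (simp add: adjust_def)

lemma pencil_adjust:
  assumes "x $ k0 \<noteq> 0"
  shows "pencil x (adjust k0 x Y W) = W"
proof -
  have "pencil x (adjust k0 x Y W) =
      (\<Sum>k\<in>UNIV. x $ k *\<^sub>R Y $ k + (if k = k0 then W - pencil x Y else 0))"
    unfolding pencil_def[of x "adjust k0 x Y W"]
    by (rule sum.cong) (auto simp: adjust_def scaleR_add_right assms)
  also have "\<dots> = W" by (simp add: sum.distrib pencil_def)
  finally show ?thesis .
qed

lemma adjust_pencil [simp]: "adjust k0 x Y (pencil x Y) = Y"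
  by (simp add: adjust_def vec_eq_iff)

lemma tendsto_pencil:
  assumes "(Y \<longlongrightarrow> Z) F"
  shows "((\<lambda>s. pencil x (Y s)) \<longlongrightarrow> pencil x Z) F"
  unfolding pencil_def by (intro tendsto_intros assms)

lemma tendsto_adjust:
  assumes "(Y \<longlongrightarrow> Z) F" "(V \<longlongrightarrow> W) F"
  shows "((\<lambda>s. adjust k0 x (Y s) (V s)) \<longlongrightarrow> adjust k0 x Z W) F"
  unfolding adjust_def
  by (intro tendsto_vec_lambda) (auto intro!: tendsto_intros tendsto_pencil assms)

text \<open>Lifts an approximation of one matrix to one of the tensor: \<open>adjust k0 x Y\<close>
  is continuous, takes \<open>T\<close> into \<open>S\<close>, and returns \<open>Y\<close> at the
  value \<open>pencil x Y\<close>.\<close>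

lemma pencil_closure:
  assumes "x \<noteq> 0" "pencil x Y \<in> closure T" "\<And>Y'. pencil x Y' \<in> T \<Longrightarrow> Y' \<in> S"
  shows "Y \<in> closure S"
proof -
  obtain k0 where k0: "x $ k0 \<noteq> 0" using assms(1) by (auto simp: vec_eq_iff)
  have "isCont (adjust k0 x Y) W" for W
    unfolding isCont_def by (intro tendsto_adjust tendsto_intros)
  then have "continuous_on (closure T) (adjust k0 x Y)"
    by (simp add: continuous_at_imp_continuous_on)
  moreover have "adjust k0 x Y ` T \<subseteq> closure S"
  proof
    fix Z assume "Z \<in> adjust k0 x Y ` T"
    then have "pencil x Z \<in> T" by (auto simp: pencil_adjust[OF k0])
    then show "Z \<in> closure S" using assms(3) closure_subset by blast
  qed
  ultimately have "adjust k0 x Y ` closure T \<subseteq> closure S"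
    by (intro image_closure_subset) auto
  then have "adjust k0 x Y (pencil x Y) \<in> closure S" using assms(2) by blast
  then show ?thesis by simp
qed

section \<open>Holomorphic dependence of eigenvectors\<close>

text \<open>A general quadratic map without constant term. The coefficients are plain functions so
  that they can be complex and depend holomorphically on a parameter entry by entry.\<close>

definition quadratic_map ::
    "('n \<Rightarrow> 'n \<Rightarrow> 'n \<Rightarrow> complex) \<Rightarrow> ('n \<Rightarrow> 'n \<Rightarrow> complex) \<Rightarrow> ('n \<Rightarrow> complex) \<Rightarrow> 'n \<Rightarrow> complex"
  where "quadratic_map G H a i =
    (\<Sum>j\<in>UNIV. \<Sum>k\<in>UNIV. G i j k * (a j * a k)) + (\<Sum>j\<in>UNIV. H i j * a j)"

lemma norm_quadratic_map_le:
  fixes a :: "'n::finite \<Rightarrow> complex"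
  assumes "\<And>i j k. cmod (G i j k) \<le> \<kappa>" "\<And>i j. cmod (H i j) \<le> \<kappa>" "\<And>j. cmod (a j) \<le> M"
  shows "cmod (quadratic_map G H a i) \<le>
    real CARD('n) * real CARD('n) * (\<kappa> * (M * M)) + real CARD('n) * (\<kappa> * M)"
proof -
  have nn: "0 \<le> \<kappa>" "0 \<le> M"
    using order_trans[OF norm_ge_zero assms(2)] order_trans[OF norm_ge_zero assms(3)] by auto
  have "cmod (G i j k * (a j * a k)) \<le> \<kappa> * (M * M)" for j k
    unfolding norm_mult using assms nn by (intro mult_mono) auto
  then have "cmod (\<Sum>k\<in>UNIV. G i j k * (a j * a k)) \<le> real CARD('n) * (\<kappa> * (M * M))" for j
    by - (rule sum_norm_bound, simp)
  then have "cmod (\<Sum>j\<in>UNIV. \<Sum>k\<in>UNIV. G i j k * (a j * a k))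
      \<le> real CARD('n) * (real CARD('n) * (\<kappa> * (M * M)))"
    by - (rule sum_norm_bound, simp)
  moreover have "cmod (H i j * a j) \<le> \<kappa> * M" for j
    unfolding norm_mult using assms nn by (intro mult_mono) auto
  then have "cmod (\<Sum>j\<in>UNIV. H i j * a j) \<le> real CARD('n) * (\<kappa> * M)"
    by - (rule sum_norm_bound, simp)
  ultimately show ?thesis
    unfolding quadratic_map_def by (intro order_trans[OF norm_triangle_ineq]) (simp add: mult.assoc)
qed

text \<open>The Lipschitz constant on the polydisc of radius \<open>M\<close>, for a contraction
  argument; products are compared through a mixed term.\<close>

lemma norm_quadratic_map_diff_le:
  fixes a b :: "'n::finite \<Rightarrow> complex"
  assumes "\<And>i j k. cmod (G i j k) \<le> \<kappa>" "\<And>i j. cmod (H i j) \<le> \<kappa>"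
    and "\<And>j. cmod (a j) \<le> M" "\<And>j. cmod (b j) \<le> M" "\<And>j. cmod (a j - b j) \<le> d"
  shows "cmod (quadratic_map G H a i - quadratic_map G H b i) \<le>
    (real CARD('n) * real CARD('n) * (\<kappa> * (2 * M)) + real CARD('n) * \<kappa>) * d"
proof -
  have nn: "0 \<le> \<kappa>" "0 \<le> M" "0 \<le> d"
    using order_trans[OF norm_ge_zero assms(2)] order_trans[OF norm_ge_zero assms(3)]
      order_trans[OF norm_ge_zero assms(5)] by auto
  have "cmod (a j * a k - b j * b k) \<le> 2 * M * d" for j k
  proof -
    have "a j * a k - b j * b k = a j * (a k - b k) + (a j - b j) * b k"
      by (simp add: algebra_simps)
    also have "cmod \<dots> \<le> M * d + d * M"
      by (intro order_trans[OF norm_triangle_ineq] add_mono; unfold norm_mult;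
          intro mult_mono) (use assms nn in auto)
    finally show ?thesis by (simp add: algebra_simps)
  qed
  then have "cmod (G i j k * (a j * a k - b j * b k)) \<le> \<kappa> * (2 * M * d)" for j k
    unfolding norm_mult using assms nn by (intro mult_mono) auto
  then have "cmod (\<Sum>k\<in>UNIV. G i j k * (a j * a k - b j * b k)) \<le> real CARD('n) * (\<kappa> * (2 * M * d))" for j
    by - (rule sum_norm_bound, simp)
  then have 1: "cmod (\<Sum>j\<in>UNIV. \<Sum>k\<in>UNIV. G i j k * (a j * a k - b j * b k))
      \<le> real CARD('n) * (real CARD('n) * (\<kappa> * (2 * M * d)))"
    by - (rule sum_norm_bound, simp)
  have "cmod (H i j * (a j - b j)) \<le> \<kappa> * d" for j
    unfolding norm_mult using assms nn by (intro mult_mono) auto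
  then have 2: "cmod (\<Sum>j\<in>UNIV. H i j * (a j - b j)) \<le> real CARD('n) * (\<kappa> * d)"
    by - (rule sum_norm_bound, simp)
  have "quadratic_map G H a i - quadratic_map G H b i =
    (\<Sum>j\<in>UNIV. \<Sum>k\<in>UNIV. G i j k * (a j * a k - b j * b k)) + (\<Sum>j\<in>UNIV. H i j * (a j - b j))"
    by (simp add: quadratic_map_def right_diff_distrib sum_subtractf)
  then show ?thesis
    using order_trans[OF norm_triangle_ineq add_mono[OF 1 2]] by (simp add: algebra_simps)
qed

text \<open>Picard iteration from \<open>v\<close>: for small \<open>t\<close> the iterates stay in
  a polydisc and converge geometrically, uniformly in \<open>s\<close>. Each iterate is polynomial
  in the coefficients, so the limit is holomorphic. \<open>\<delta>\<close> is chosen before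
  \<open>s\<close>, so one \<open>t\<close> works on all of \<open>S\<close>.\<close>

lemma holomorphic_quadratic_fixed_point:
  fixes G :: "complex \<Rightarrow> 'n::finite \<Rightarrow> 'n \<Rightarrow> 'n \<Rightarrow> complex"
  assumes hol: "\<And>i j k. (\<lambda>s. G s i j k) holomorphic_on S" "\<And>i j. (\<lambda>s. H s i j) holomorphic_on S"
    and S: "open S"
    and bound: "\<And>s i j k. s \<in> S \<Longrightarrow> cmod (G s i j k) \<le> \<kappa>" "\<And>s i j. s \<in> S \<Longrightarrow> cmod (H s i j) \<le> \<kappa>"
  obtains \<delta> where "\<delta> > 0"
    and "\<And>t. cmod t < \<delta> \<Longrightarrow> \<exists>a. (\<forall>i. (\<lambda>s. a s i) holomorphic_on S) \<and>
      (\<forall>s\<in>S. (\<forall>i. a s i = v i + t * quadratic_map (G s) (H s) (a s) i) \<and>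
        ((\<forall>i j k. G s i j k \<in> \<real>) \<and> (\<forall>i j. H s i j \<in> \<real>) \<and> (\<forall>i. v i \<in> \<real>) \<and> t \<in> \<real> \<longrightarrow>
          (\<forall>i. a s i \<in> \<real>)))"
proof -
  \<comment> \<open>One more than the size of \<open>v\<close>, which leaves room for a correction
    of norm at most 1.\<close>
  define M where "M = (\<Sum>i\<in>UNIV. cmod (v i)) + 1"
  have vM: "cmod (v i) \<le> M - 1" for i
    unfolding M_def using member_le_sum[of i UNIV "\<lambda>i. cmod (v i)"] by auto
  then have M1: "M \<ge> 1" by (metis M_def add.commute le_add_same_cancel1 norm_ge_zero sum_nonneg)
  \<comment> \<open>If \<open>S\<close> is empty, \<open>\<kappa>\<close> may be negative.\<close>
  define \<kappa>' where "\<kappa>' = max \<kappa> 0"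
  have \<kappa>': "\<kappa>' \<ge> 0" "\<And>s i j k. s \<in> S \<Longrightarrow> cmod (G s i j k) \<le> \<kappa>'" "\<And>s i j. s \<in> S \<Longrightarrow> cmod (H s i j) \<le> \<kappa>'"
    using bound by (auto simp: \<kappa>'_def le_max_iff_disj)
  define K where "K = real CARD('n) * real CARD('n) * (\<kappa>' * (M * M)) + real CARD('n) * (\<kappa>' * M)"
  define L where "L = real CARD('n) * real CARD('n) * (\<kappa>' * (2 * M)) + real CARD('n) * \<kappa>'"
  have KL: "K \<ge> 0" "L \<ge> 0" unfolding K_def L_def using \<kappa>' M1 by auto
  \<comment> \<open>The first bound keeps the iterates in the polydisc, the second gives contraction
    factor 1/2; adding 1 avoids division by 0.\<close>
  define \<delta> where "\<delta> = min (1 / (K + 1)) (1 / (2 * (L + 1)))"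
  show thesis
  proof (rule that)
    show "\<delta> > 0" unfolding \<delta>_def using KL by auto
    fix t assume t: "cmod t < \<delta>"
    have tK: "cmod t * K \<le> 1"
    proof -
      have "cmod t * K \<le> 1 / (K + 1) * (K + 1)"
        using t KL by (intro mult_mono) (auto simp: \<delta>_def)
      then show ?thesis using KL by simp
    qed
    have tL: "cmod t * L \<le> 1 / 2"
    proof -
      have "cmod t * L \<le> 1 / (2 * (L + 1)) * (L + 1)"
        using t KL by (intro mult_mono) (auto simp: \<delta>_def)
      also have "\<dots> = 1 / 2" using KL by simp
      finally show ?thesis .
    qed
    define b where "b n s = ((\<lambda>a i. v i + t * quadratic_map (G s) (H s) a i) ^^ n) v" for n s
    have b0: "b 0 s i = v i" for s i by (simp add: b_def)
    have bS: "b (Suc n) s i = v i + t * quadratic_map (G s) (H s) (b n s) i" for n s i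
      by (simp add: b_def)
    have small: "cmod (t * quadratic_map (G s) (H s) a i) \<le> 1"
      if "s \<in> S" "\<And>j. cmod (a j) \<le> M" for s a i
    proof -
      have "cmod (quadratic_map (G s) (H s) a i) \<le> K"
        unfolding K_def using that \<kappa>' by (intro norm_quadratic_map_le) auto
      then have "cmod (t * quadratic_map (G s) (H s) a i) \<le> cmod t * K"
        unfolding norm_mult by (intro mult_left_mono) auto
      then show ?thesis using tK by linarith
    qed
    have bM: "cmod (b n s i) \<le> M" if "s \<in> S" for n s i
    proof (induction n arbitrary: i)
      case 0
      show ?case using vM[of i] by (simp add: b0)
    next
      case (Suc n)
      show ?case
        using norm_triangle_ineq[of "v i" "t * quadratic_map (G s) (H s) (b n s) i"]
          small[OF that, of "b n s" i] Suc vM[of i] by (simp add: bS)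
    qed
    have step: "cmod (b (Suc n) s i - b n s i) \<le> (1 / 2) ^ n" if "s \<in> S" for n s i
    proof (induction n arbitrary: i)
      case 0
      show ?case using small[OF that, of "b 0 s" i] bM[OF that, of 0] by (simp add: bS b0)
    next
      case (Suc n)
      have "b (Suc (Suc n)) s i - b (Suc n) s i =
          t * (quadratic_map (G s) (H s) (b (Suc n) s) i - quadratic_map (G s) (H s) (b n s) i)"
        by (simp add: bS[of "Suc n"] bS[of n] algebra_simps)
      also have "cmod \<dots> \<le> cmod t * (L * (1 / 2) ^ n)"
        unfolding norm_mult L_def using that Suc bM \<kappa>'
        by (intro mult_left_mono norm_quadratic_map_diff_le) auto
      also have "\<dots> \<le> 1 / 2 * (1 / 2) ^ n"
        unfolding mult.assoc[symmetric] by (intro mult_right_mono tL) auto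
      finally show ?case by simp
    qed
    \<comment> \<open>The limit is written as a telescoping series so that the Weierstrass test with
      terms (1/2)^n gives uniform convergence.\<close>
    define a where "a s i = v i + (\<Sum>n. b (Suc n) s i - b n s i)" for s i
    have ul: "uniform_limit S (\<lambda>n s. b n s i) (\<lambda>s. a s i) sequentially" for i
    proof -
      have "uniform_limit S (\<lambda>n s. \<Sum>m<n. b (Suc m) s i - b m s i)
          (\<lambda>s. \<Sum>n. b (Suc n) s i - b n s i) sequentially"
        by (rule Weierstrass_m_test[where M = "\<lambda>n. (1 / 2) ^ n"]) (use step in \<open>auto simp: summable_geometric\<close>)
      then have "uniform_limit S (\<lambda>n s. v i + (\<Sum>m<n. b (Suc m) s i - b m s i)) (\<lambda>s. a s i) sequentially"
        unfolding a_def by (intro uniform_limit_add uniform_limit_const)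
      moreover have "v i + (\<Sum>m<n. b (Suc m) s i - b m s i) = b n s i" for n s
        using sum_lessThan_telescope[of "\<lambda>m. b m s i" n] by (simp add: b0)
      ultimately show ?thesis by simp
    qed
    have lim: "(\<lambda>n. b n s i) \<longlonglongrightarrow> a s i" if "s \<in> S" for s i
      using tendsto_uniform_limitI[OF ul that] .
    have bhol: "(\<lambda>s. b n s i) holomorphic_on S" for n i
    proof (induction n arbitrary: i)
      case 0
      show ?case by (simp add: b0)
    next
      case (Suc n)
      show ?case unfolding bS quadratic_map_def by (intro holomorphic_intros hol Suc)
    qed
    show "\<exists>a. (\<forall>i. (\<lambda>s. a s i) holomorphic_on S) \<and>
      (\<forall>s\<in>S. (\<forall>i. a s i = v i + t * quadratic_map (G s) (H s) (a s) i) \<and>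
        ((\<forall>i j k. G s i j k \<in> \<real>) \<and> (\<forall>i j. H s i j \<in> \<real>) \<and> (\<forall>i. v i \<in> \<real>) \<and> t \<in> \<real> \<longrightarrow>
          (\<forall>i. a s i \<in> \<real>)))"
    proof (intro exI[of _ a] conjI allI ballI impI)
      show "(\<lambda>s. a s i) holomorphic_on S" for i
      proof (rule holomorphic_uniform_sequence[OF S bhol])
        fix x assume "x \<in> S"
        then obtain d where "d > 0" "cball x d \<subseteq> S" using S open_contains_cball by blast
        then show "\<exists>d>0. cball x d \<subseteq> S \<and> uniform_limit (cball x d) (\<lambda>n s. b n s i) (\<lambda>s. a s i) sequentially"
          using uniform_limit_on_subset[OF ul] by blast
      qed
    next
      fix s i assume s: "s \<in> S"
      have "(\<lambda>n. b (Suc n) s i) \<longlonglongrightarrow> v i + t * quadratic_map (G s) (H s) (a s) i"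
        unfolding bS quadratic_map_def by (intro tendsto_intros lim s)
      moreover have "(\<lambda>n. b (Suc n) s i) \<longlonglongrightarrow> a s i"
        using lim[OF s] by (rule LIMSEQ_Suc)
      ultimately show "a s i = v i + t * quadratic_map (G s) (H s) (a s) i"
        using LIMSEQ_unique by blast
    next
      \<comment> \<open>Real data keep all iterates real, and the reals are closed in the complex
        plane.\<close>
      fix s i assume s: "s \<in> S" and real: "(\<forall>i j k. G s i j k \<in> \<real>) \<and> (\<forall>i j. H s i j \<in> \<real>) \<and> (\<forall>i. v i \<in> \<real>) \<and> t \<in> \<real>"
      have "b n s i \<in> \<real>" for n i
      proof (induction n arbitrary: i)
        case 0
        show ?case using real by (simp add: b0)
      next
        case (Suc n)
        show ?case unfolding bS quadratic_map_def
          using real Suc by (intro Reals_add Reals_mult sum_in_Reals) auto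
      qed
      then show "a s i \<in> \<real>"
        using Lim_in_closed_set[OF closed_complex_Reals _ _ lim[OF s]] by auto
    qed
  qed
qed

lemma uniform_bound_finite_family:
  fixes f :: "'i::finite \<Rightarrow> complex \<Rightarrow> complex"
  assumes "compact K" "\<And>i. continuous_on K (f i)"
  obtains B where "\<And>i x. x \<in> K \<Longrightarrow> cmod (f i x) \<le> B"
proof -
  have "\<exists>b. \<forall>x\<in>K. cmod (f i x) \<le> b" for i
    using compact_imp_bounded[OF compact_continuous_image[OF assms(2,1)], of i]
    by (auto simp: bounded_iff)
  then obtain b where b: "\<And>i x. x \<in> K \<Longrightarrow> cmod (f i x) \<le> b i" by metis
  show thesis
  proof (rule that)
    fix i x assume x: "x \<in> K"
    have "cmod (f i x) \<le> \<bar>b i\<bar>" using b[OF x, of i] by linarith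
    also have "\<dots> \<le> (\<Sum>i\<in>UNIV. \<bar>b i\<bar>)" by (rule member_le_sum) auto
    finally show "cmod (f i x) \<le> (\<Sum>i\<in>UNIV. \<bar>b i\<bar>)" .
  qed
qed

section \<open>The fixed-point equation for nearby eigenvectors\<close>

definition eigen_map :: "real^'n^'n \<Rightarrow> real^'n^'n \<Rightarrow> real^'n \<Rightarrow> real^'n \<Rightarrow> real^'n"
  where "eigen_map R C l a = R *v ((l \<bullet> (C *v a)) *\<^sub>R a - C *v a)"

text \<open>As \<open>R\<close> maps into the kernel of \<open>l\<close>, a fixed point has
  \<open>l \<bullet> a = 1\<close>. Hence \<open>?z\<close> lies in that kernel, where
  \<open>N\<close> undoes \<open>R\<close>, and \<open>N *v a = t *\<^sub>R ?z\<close> is the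
  eigenvalue equation.\<close>

lemma eigen_map_fixed_point:
  assumes red: "reduced_resolvent N v l R" and a: "a = v + t *\<^sub>R eigen_map R C l a"
  shows "(N + t *\<^sub>R C) *v a = (t * (l \<bullet> (C *v a))) *\<^sub>R a"
proof -
  let ?z = "(l \<bullet> (C *v a)) *\<^sub>R a - C *v a"
  have "l \<bullet> a = 1"
    using red by (subst a) (simp add: eigen_map_def reduced_resolvent_def inner_add_right)
  then have "l \<bullet> ?z = 0" by (simp add: inner_diff_right)
  moreover have "N *v a = N *v (v + t *\<^sub>R (R *v ?z))" using a by (simp add: eigen_map_def)
  ultimately have "N *v a = t *\<^sub>R ?z"
    using red by (simp add: reduced_resolvent_def matrix_vector_right_distrib matrix_vector_mult_scaleR)
  then show ?thesis
    by (simp add: matrix_vector_mult_add_rdistrib scaleR_mat_mult algebra_simps)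
qed

text \<open>Stated over any commutative ring so that the same coefficients serve for real matrices
  and for their complexification in the parameter.\<close>

definition eigen_quad :: "('n \<Rightarrow> 'n \<Rightarrow> 'a::comm_ring_1) \<Rightarrow> ('n \<Rightarrow> 'n \<Rightarrow> 'a) \<Rightarrow> ('n::finite \<Rightarrow> 'a) \<Rightarrow> 'n \<Rightarrow> 'n \<Rightarrow> 'n \<Rightarrow> 'a"
  where "eigen_quad R C l i j k = R i k * (\<Sum>q\<in>UNIV. l q * C q j)"

definition eigen_lin :: "('n \<Rightarrow> 'n \<Rightarrow> 'a::comm_ring_1) \<Rightarrow> ('n \<Rightarrow> 'n \<Rightarrow> 'a) \<Rightarrow> 'n::finite \<Rightarrow> 'n \<Rightarrow> 'a"
  where "eigen_lin R C i j = - (\<Sum>p\<in>UNIV. R i p * C p j)"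

lemma eigen_map_expand:
  "eigen_map R C l a $ i =
    (\<Sum>j\<in>UNIV. \<Sum>k\<in>UNIV. eigen_quad (\<lambda>i j. R $ i $ j) (\<lambda>i j. C $ i $ j) (\<lambda>i. l $ i) i j k * (a $ j * a $ k)) +
    (\<Sum>j\<in>UNIV. eigen_lin (\<lambda>i j. R $ i $ j) (\<lambda>i j. C $ i $ j) i j * a $ j)"
proof -
  let ?g = "\<lambda>j. \<Sum>q\<in>UNIV. l $ q * C $ q $ j"
  have lC: "l \<bullet> (C *v a) = (\<Sum>j\<in>UNIV. ?g j * a $ j)"
    unfolding inner_vec_def matrix_vector_mult_def
    by (simp add: sum_distrib_left sum_distrib_right mult.assoc) (rule sum.swap)
  have "eigen_map R C l a $ i = (l \<bullet> (C *v a)) * (R *v a) $ i - (R *v (C *v a)) $ i"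
    by (simp add: eigen_map_def matrix_vector_mult_diff_distrib matrix_vector_mult_scaleR)
  also have "(l \<bullet> (C *v a)) * (R *v a) $ i =
      (\<Sum>j\<in>UNIV. \<Sum>k\<in>UNIV. (R $ i $ k * ?g j) * (a $ j * a $ k))"
  proof -
    have "(R *v a) $ i = (\<Sum>k\<in>UNIV. R $ i $ k * a $ k)" by (simp add: matrix_vector_mult_def)
    then show ?thesis by (simp only: lC sum_product) (simp add: mult_ac)
  qed
  also have "(R *v (C *v a)) $ i = (\<Sum>j\<in>UNIV. (\<Sum>p\<in>UNIV. R $ i $ p * C $ p $ j) * a $ j)"
    by (simp add: matrix_vector_mul_assoc) (simp add: matrix_vector_mult_def matrix_matrix_mult_def)
  finally show ?thesis
    by (simp add: eigen_quad_def eigen_lin_def sum_negf)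
qed

lemma of_real_eigen_map:
  "complex_of_real (eigen_map R C l a $ i) =
    quadratic_map
      (eigen_quad (\<lambda>i j. of_real (R $ i $ j)) (\<lambda>i j. of_real (C $ i $ j)) (\<lambda>i. of_real (l $ i)))
      (eigen_lin (\<lambda>i j. of_real (R $ i $ j)) (\<lambda>i j. of_real (C $ i $ j))) (\<lambda>j. of_real (a $ j)) i"
  by (simp add: eigen_map_expand quadratic_map_def eigen_quad_def eigen_lin_def)

section \<open>Spanning by eigenvectors\<close>

text \<open>An orthogonal matrix takes the axis to \<open>v\<close>; a shear along \<open>v\<close>
  then fixes \<open>v\<close> and turns the functional \<open>l\<close> into the inner product with
  \<open>v\<close>.\<close>

lemma adapted_coordinates:
  fixes v l :: "real^'n" and i0 :: 'n
  assumes "norm v = 1" "l \<bullet> v = 1"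
  obtains P P' where "\<And>x. P *v (P' *v x) = x" "\<And>x. P' *v (P *v x) = x"
    "P *v axis i0 1 = v" "\<And>y. l \<bullet> (P *v y) = y $ i0"
proof -
  have vv: "v \<bullet> v = 1" using assms(1) by (simp add: norm_eq_1)
  obtain U where U: "orthogonal_matrix U" "U *v axis i0 1 = v"
    using orthogonal_matrix_exists_basis[OF assms(1)] by metis
  define U' where "U' = transpose U"
  have UU: "U *v (U' *v x) = x" "U' *v (U *v x) = x" for x
    using U(1) by (simp_all add: orthogonal_matrix_def U'_def matrix_vector_mul_assoc
        del: transpose_matrix_vector)
  have vU: "v \<bullet> (U *v y) = y $ i0" for y
  proof -
    have "v \<bullet> (U *v y) = (U' *v v) \<bullet> y"
      by (simp add: U'_def dot_lmul_matrix)
    also have "U' *v v = axis i0 1" using UU(2)[of "axis i0 1"] by (simp add: U(2))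
    finally show ?thesis by (simp add: inner_axis')
  qed
  define S where "S = mat 1 + outer v (v - l)"
  define S' where "S' = mat 1 - outer v (v - l)"
  have S: "S *v x = x + ((v - l) \<bullet> x) *\<^sub>R v" "S' *v x = x - ((v - l) \<bullet> x) *\<^sub>R v" for x
    by (simp_all add: S_def S'_def matrix_vector_mult_add_rdistrib matrix_vector_mult_diff_rdistrib)
  have wv: "(v - l) \<bullet> v = 0" by (simp add: inner_diff_left vv assms)
  have SS: "S *v (S' *v x) = x" "S' *v (S *v x) = x" for x
    unfolding S by (simp_all add: inner_diff_right inner_add_right wv)
  show thesis
  proof (rule that[of "S ** U" "U' ** S'"])
    show "(S ** U) *v ((U' ** S') *v x) = x" "(U' ** S') *v ((S ** U) *v x) = x" for x
      by (simp_all add: UU SS flip: matrix_vector_mul_assoc)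
    show "(S ** U) *v axis i0 1 = v"
      by (simp add: U S wv flip: matrix_vector_mul_assoc)
    show "l \<bullet> ((S ** U) *v y) = y $ i0" for y
      by (simp add: S inner_add_right inner_diff_left assms vU flip: matrix_vector_mul_assoc)
  qed
qed

text \<open>Both \<open>p\<close> and X q have degree at most n, so above degree n only X^n p
  contributes. This kills every coefficient of \<open>p\<close> except the constant one, which is
  killed in degree 0.\<close>

lemma rational_normal_curve_relation:
  fixes p q :: "real poly"
  assumes "n > 0" "\<And>k. k \<ge> n \<Longrightarrow> coeff p k = 0" "\<And>k. k \<ge> n \<Longrightarrow> coeff q k = 0"
    and "p * (1 + monom 1 n) + monom 1 1 * q = 0"
  shows "p = 0 \<and> q = 0"
proof -
  have c: "coeff p k + (if k < n then 0 else coeff p (k - n)) + (if k < 1 then 0 else coeff q (k - 1)) = 0"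
    for k
  proof -
    have "p + monom 1 n * p + monom 1 1 * q = 0" using assms(4) by (simp add: algebra_simps)
    then have "coeff (p + monom 1 n * p + monom 1 1 * q) k = 0" by simp
    then show ?thesis by (auto simp add: coeff_monom_mult split: if_splits)
  qed
  have "coeff p k = 0" for k
  proof (cases k)
    case 0
    then show ?thesis using c[of 0] assms(1) by simp
  next
    case (Suc m)
    then show ?thesis using c[of "n + k"] assms(2)[of "n + k"] assms(3)[of "n + m"] by simp
  qed
  then have "p = 0" by (simp add: poly_eq_iff)
  then show ?thesis using assms(4) by (simp add: monom_eq_0_iff)
qed

text \<open>Solving the recurrence gives coordinates w^m with w = t / (1 - t \<beta>), where \<beta>
  is the last coordinate; then \<beta> = w^(n-1) yields t = w / (1 + w^n). After clearing the
  denominator, the relation is a polynomial identity in w with infinitely many roots.\<close>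

lemma cyclic_curve_spans:
  fixes e :: "nat \<Rightarrow> 'n::finite" and c d :: "real^'n"
  assumes n: "n = CARD('n)" "n \<ge> 2" and e: "bij_betw e {..<n} UNIV" and T: "infinite T"
    and \<alpha>0: "\<And>t. t \<in> T \<Longrightarrow> \<alpha> t $ e 0 = 1"
    and \<alpha>: "\<And>t m. t \<in> T \<Longrightarrow> Suc m < n \<Longrightarrow>
      \<alpha> t $ e (Suc m) = t * (\<alpha> t $ e (n - 1) * \<alpha> t $ e (Suc m) + \<alpha> t $ e m)"
    and rel: "\<And>t. t \<in> T \<Longrightarrow> c \<bullet> \<alpha> t + t * (d \<bullet> \<alpha> t) = 0"
  shows "c = 0 \<and> d = 0"
proof -
  define p where "p f = (\<Sum>m<n. monom (f $ e m) m)" for f :: "real^'n"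
  have coeff_p: "coeff (p f) k = (if k < n then f $ e k else 0)" for f k
    by (simp add: p_def coeff_sum coeff_monom)
  define w where "w t = t / (1 - t * \<alpha> t $ e (n - 1))" for t
  have wt: "t = w t / (1 + w t ^ n) \<and> 1 + w t ^ n \<noteq> 0 \<and> (\<forall>m<n. \<alpha> t $ e m = w t ^ m)"
    if t: "t \<in> T" for t
  proof -
    let ?\<beta> = "\<alpha> t $ e (n - 1)"
    \<comment> \<open>Otherwise the first recurrence, available as n is at least 2, gives t = 0,
      contradicting t \<beta> = 1.\<close>
    have nz: "1 - t * ?\<beta> \<noteq> 0"
    proof
      assume "1 - t * ?\<beta> = 0"
      moreover have "\<alpha> t $ e 1 = t * (?\<beta> * \<alpha> t $ e 1 + 1)"
        using \<alpha>[OF t, of 0] \<alpha>0[OF t] n by simp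
      then have "\<alpha> t $ e 1 * (1 - t * ?\<beta>) = t" by (simp add: algebra_simps)
      ultimately show False by auto
    qed
    have pow: "\<alpha> t $ e m = w t ^ m" if "m < n" for m
      using that
    proof (induction m)
      case 0
      then show ?case by (simp add: \<alpha>0[OF t])
    next
      case (Suc m)
      have "\<alpha> t $ e (Suc m) * (1 - t * ?\<beta>) = t * \<alpha> t $ e m"
        using \<alpha>[OF t Suc.prems] by (simp add: algebra_simps)
      then have "\<alpha> t $ e (Suc m) = w t * \<alpha> t $ e m"
        using nz by (simp add: w_def field_simps)
      then show ?case using Suc by simp
    qed
    have "w t * (1 - t * ?\<beta>) = t" using nz by (simp add: w_def)
    moreover have "?\<beta> = w t ^ (n - 1)" using pow n by simp
    moreover have "w t * w t ^ (n - 1) = w t ^ n"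
      using n by (metis Suc_diff_1 gr0I not_numeral_le_zero power_Suc)
    ultimately have w: "w t = t * (1 + w t ^ n)" by (simp add: algebra_simps)
    have "1 + w t ^ n \<noteq> 0"
    proof
      assume z: "1 + w t ^ n = 0"
      then have "w t = 0" using w by simp
      then show False using z n(2) by (simp add: power_0_left)
    qed
    then show ?thesis using w pow by (simp add: field_simps)
  qed
  \<comment> \<open>The formula for \<open>t\<close> recovers it from \<open>w t\<close>.\<close>
  have "inj_on w T" by (rule inj_onI) (metis wt)
  then have "infinite (w ` T)" using T finite_imageD by blast
  moreover have "w ` T \<subseteq> {x. poly (p c * (1 + monom 1 n) + monom 1 1 * p d) x = 0}"
  proof
    fix x assume "x \<in> w ` T"
    then obtain t where t: "t \<in> T" "x = w t" by blast
    have inner: "f \<bullet> \<alpha> t = poly (p f) x" for f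
    proof -
      have "f \<bullet> \<alpha> t = (\<Sum>m<n. f $ e m * \<alpha> t $ e m)"
        unfolding inner_vec_def by (simp add: sum.reindex_bij_betw[OF e, symmetric])
      also have "\<dots> = poly (p f) x" using wt[OF t(1)] t(2) by (simp add: p_def poly_sum poly_monom)
      finally show ?thesis .
    qed
    have nz: "1 + x ^ n \<noteq> 0" and tx: "t = x / (1 + x ^ n)"
      using wt[OF t(1)] t(2) by blast+
    have "poly (p c) x + x / (1 + x ^ n) * poly (p d) x = 0"
      using rel[OF t(1)] by (simp add: inner flip: tx)
    then have "poly (p c) x * (1 + x ^ n) + x * poly (p d) x = 0"
      using nz by (simp add: field_simps)
    then show "x \<in> {x. poly (p c * (1 + monom 1 n) + monom 1 1 * p d) x = 0}"
      by (simp add: poly_monom)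
  qed
  ultimately have "p c * (1 + monom 1 n) + monom 1 1 * p d = 0"
    using poly_roots_finite finite_subset by blast
  then have "p c = 0 \<and> p d = 0"
    by (intro rational_normal_curve_relation[of n]) (use n in \<open>auto simp: coeff_p\<close>)
  then have "f $ e m = 0" if "f \<in> {c, d}" "m < n" for f m
    using that coeff_p[of f m] by auto
  moreover have "\<exists>m<n. i = e m" for i using e by (metis UNIV_I bij_betw_iff_bijections lessThan_iff)
  ultimately show ?thesis by (metis insertCI vec_eq_iff zero_index)
qed

text \<open>The conclusion says that the vectors (1, t) \<otimes> a span. \<open>C'\<close> depends
  only on \<open>v\<close> and \<open>l\<close>, so a single deformation direction can be used for
  all slices of a tensor at once. A nonzero determinant at \<open>s = 1\<close> is carried to small
  \<open>s > 0\<close> by analyticity.\<close>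

lemma generic_eigenvector_span:
  fixes v l :: "real^'n"
  assumes v: "norm v = 1" "l \<bullet> v = 1" and n: "CARD('n) \<ge> 2"
  obtains C' where "\<And>R C. \<forall>\<^sub>F s in at_right 0. \<forall>c d.
    (\<forall>t a. a = v + t *\<^sub>R eigen_map ((1 - s) *\<^sub>R R + s *\<^sub>R (mat 1 - outer v l)) ((1 - s) *\<^sub>R C + s *\<^sub>R C') l a
      \<longrightarrow> c \<bullet> a + t * (d \<bullet> a) = 0) \<longrightarrow> c = 0 \<and> d = 0"
proof -
  define n where "n = CARD('n)"
  obtain e :: "nat \<Rightarrow> 'n" where e: "bij_betw e {..<n} UNIV"
    using ex_bij_betw_nat_finite[of "UNIV :: 'n set"] by (auto simp: n_def atLeast0LessThan)
  have e_eq: "e m = e m' \<longleftrightarrow> m = m'" if "m < n" "m' < n" for m m'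
    using e that by (auto simp: bij_betw_def inj_on_def)
  obtain P P' where P: "\<And>x. P *v (P' *v x) = x" "\<And>x. P' *v (P *v x) = x"
    "P *v axis (e 0) 1 = v" "\<And>y. l \<bullet> (P *v y) = y $ e 0"
    using adapted_coordinates[OF v] by metis
  define idx where "idx = inv_into {..<n} e"
  have idx: "idx (e m) = m" if "m < n" for m
    using that e by (simp add: idx_def bij_betw_def inv_into_f_f)
  \<comment> \<open>In adapted coordinates \<open>- C'\<close> is the cyclic shift with one sign flipped.  At \<open>s = 1\<close> the
    fixed points then lie on the rational normal curve \<open>(1, w, \<dots>, w\<^sup>n\<^sup>-\<^sup>1)\<close> with \<open>t = w / (1 + w\<^sup>n)\<close>.\<close>
  define Sh :: "real^'n^'n" where "Sh = (\<chi> i j. if idx i = Suc (idx j) then 1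
    else if idx i = 0 \<and> Suc (idx j) = n then -1 else 0)"
  have Sh0: "(Sh *v x) $ e 0 = - x $ e (n - 1)" for x
  proof -
    have "(Sh *v x) $ e 0 = (\<Sum>m<n. Sh $ e 0 $ e m * x $ e m)"
      by (simp add: matrix_vector_mult_def sum.reindex_bij_betw[OF e, symmetric])
    also have "\<dots> = (\<Sum>m<n. if m = n - 1 then - x $ e m else 0)"
      using assms(3) by (intro sum.cong) (auto simp: Sh_def idx n_def)
    finally show ?thesis using assms(3) by (simp add: n_def)
  qed
  have ShS: "(Sh *v x) $ e (Suc m) = x $ e m" if "Suc m < n" for x m
  proof -
    have "(Sh *v x) $ e (Suc m) = (\<Sum>k<n. Sh $ e (Suc m) $ e k * x $ e k)"
      by (simp add: matrix_vector_mult_def sum.reindex_bij_betw[OF e, symmetric])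
    also have "\<dots> = (\<Sum>k<n. if k = m then x $ e k else 0)"
      using that by (intro sum.cong) (auto simp: Sh_def idx n_def)
    finally show ?thesis using that by simp
  qed
  define C' where "C' = - (P ** Sh ** P')"
  have C': "C' *v x = - (P *v (Sh *v (P' *v x)))" for x
  proof -
    have "C' *v x = - ((P ** Sh ** P') *v x)"
      using scaleR_mat_mult[of "-1" "P ** Sh ** P'" x] by (simp add: C'_def)
    then show ?thesis by (simp flip: matrix_vector_mul_assoc)
  qed
  define Q where "Q = mat 1 - outer v l"
  have Q: "Q *v x = x - (l \<bullet> x) *\<^sub>R v" for x
    by (simp add: Q_def matrix_vector_mult_diff_rdistrib)
  have P'v: "P' *v v = axis (e 0) 1" using P(2)[of "axis (e 0) 1"] by (simp add: P(3))
  have l: "l \<bullet> x = (P' *v x) $ e 0" for x using P(4)[of "P' *v x"] by (simp add: P(1))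
  have at_1: "(P' *v a) $ e 0 = 1"
      "Suc m < n \<Longrightarrow> (P' *v a) $ e (Suc m) =
        t * ((P' *v a) $ e (n - 1) * (P' *v a) $ e (Suc m) + (P' *v a) $ e m)"
    if a: "a = v + t *\<^sub>R eigen_map Q C' l a" for a t m
  proof -
    let ?\<alpha> = "P' *v a"
    define z where "z = (l \<bullet> (C' *v a)) *\<^sub>R a - C' *v a"
    \<comment> \<open>The minus sign in \<open>C'\<close> and the flipped corner of
      \<open>Sh\<close> cancel, so the eigenvalue factor is the last coordinate itself.\<close>
    have lC: "l \<bullet> (C' *v a) = ?\<alpha> $ e (n - 1)"
      by (simp add: C' P(4) Sh0)
    have z: "P' *v z = ?\<alpha> $ e (n - 1) *\<^sub>R ?\<alpha> + Sh *v ?\<alpha>"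
      unfolding z_def lC by (simp add: C' matrix_vector_right_distrib matrix_vector_mult_scaleR P(2))
    have "?\<alpha> = P' *v (v + t *\<^sub>R (Q *v z))"
      using a by (simp add: eigen_map_def z_def)
    then have \<alpha>: "?\<alpha> = axis (e 0) 1 + t *\<^sub>R (P' *v z - ((P' *v z) $ e 0) *\<^sub>R axis (e 0) 1)"
      by (simp add: Q l matrix_vector_right_distrib matrix_vector_mult_diff_distrib
          matrix_vector_mult_scaleR P'v)
    show "?\<alpha> $ e 0 = 1" by (subst \<alpha>) (simp add: axis_def)
    assume m: "Suc m < n"
    then have "e (Suc m) \<noteq> e 0" using e_eq[of "Suc m" 0] by simp
    then show "?\<alpha> $ e (Suc m) = t * (?\<alpha> $ e (n - 1) * ?\<alpha> $ e (Suc m) + ?\<alpha> $ e m)"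
      by (subst \<alpha>) (simp add: axis_def z ShS[OF m])
  qed
  show thesis
  proof (rule that, fold Q_def)
    fix R C :: "real^'n^'n"
    define Rs Cs where "Rs s = (1 - s) *\<^sub>R R + s *\<^sub>R Q" and "Cs s = (1 - s) *\<^sub>R C + s *\<^sub>R C'" for s
    define Rc Cc where "Rc s i j = (1 - s) * of_real (R $ i $ j) + s * of_real (Q $ i $ j)"
      and "Cc s i j = (1 - s) * of_real (C $ i $ j) + s * of_real (C' $ i $ j)" for s :: complex and i j
    have real: "Rc (of_real s) i j = of_real (Rs s $ i $ j)" "Cc (of_real s) i j = of_real (Cs s $ i $ j)"
      for s i j by (simp_all add: Rc_def Cc_def Rs_def Cs_def)
    define G where "G s = eigen_quad (Rc s) (Cc s) (\<lambda>i. of_real (l $ i))" for s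
    define H where "H s = eigen_lin (Rc s) (Cc s)" for s
    have hol: "(\<lambda>s. G s i j k) holomorphic_on S" "(\<lambda>s. H s i j) holomorphic_on S" for i j k S
      unfolding G_def H_def eigen_quad_def eigen_lin_def Rc_def Cc_def by (intro holomorphic_intros)+
    have real_map: "of_real (eigen_map (Rs s) (Cs s) l a $ i) =
        quadratic_map (G (of_real s)) (H (of_real s)) (\<lambda>j. of_real (a $ j)) i" for s a i
      unfolding of_real_eigen_map G_def H_def real[abs_def] ..
    have realGH: "G (of_real s) i j k \<in> \<real>" "H (of_real s) i j \<in> \<real>" for s i j k
      unfolding G_def H_def eigen_quad_def eigen_lin_def real
      by (intro Reals_mult Reals_minus sum_in_Reals Reals_of_real)+
    \<comment> \<open>The coefficients are polynomial in \<open>s\<close>, hence bounded on the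
      closed disc. The open disc of radius 2 contains both \<open>s = 0\<close> and
      \<open>s = 1\<close>, so one \<open>\<delta>\<close> serves at both ends.\<close>
    obtain B1 where B1: "\<And>x s. s \<in> cball 0 2 \<Longrightarrow> cmod (case x of (i, j, k) \<Rightarrow> G s i j k) \<le> B1"
      using uniform_bound_finite_family[of "cball 0 2" "\<lambda>x s. case x of (i, j, k) \<Rightarrow> G s i j k"]
        holomorphic_on_imp_continuous_on[OF hol(1)] by (auto simp: split_def)
    obtain B2 where B2: "\<And>x s. s \<in> cball 0 2 \<Longrightarrow> cmod (case x of (i, j) \<Rightarrow> H s i j) \<le> B2"
      using uniform_bound_finite_family[of "cball 0 2" "\<lambda>x s. case x of (i, j) \<Rightarrow> H s i j"]
        holomorphic_on_imp_continuous_on[OF hol(2)] by (auto simp: split_def)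
    let ?S = "ball (0::complex) 2"
    have bound: "cmod (G s i j k) \<le> max B1 B2" "cmod (H s i j) \<le> max B1 B2" if "s \<in> ?S" for s i j k
      using that B1[of s "(i, j, k)"] B2[of s "(i, j)"] by (auto simp: le_max_iff_disj)
    obtain \<delta> where \<delta>: "\<delta> > 0"
      "\<And>t. cmod t < \<delta> \<Longrightarrow> \<exists>a. (\<forall>i. (\<lambda>s. a s i) holomorphic_on ?S) \<and>
        (\<forall>s\<in>?S. (\<forall>i. a s i = of_real (v $ i) + t * quadratic_map (G s) (H s) (a s) i) \<and>
          ((\<forall>i j k. G s i j k \<in> \<real>) \<and> (\<forall>i j. H s i j \<in> \<real>) \<and> (\<forall>i. of_real (v $ i) \<in> (\<real> :: complex set)) \<and> t \<in> \<real> \<longrightarrow>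
            (\<forall>i. a s i \<in> \<real>)))"
      by (rule holomorphic_quadratic_fixed_point[where G = G and H = H and S = ?S
            and v = "\<lambda>i. of_real (v $ i)", OF hol open_ball bound]) (assumption, assumption, rule that)
    define good where "good t a \<longleftrightarrow> (\<forall>i. (\<lambda>s. a s i) holomorphic_on ?S) \<and>
        (\<forall>s\<in>?S. \<forall>i. a s i = of_real (v $ i) + of_real t * quadratic_map (G s) (H s) (a s) i) \<and>
        (\<forall>s i. of_real s \<in> ?S \<longrightarrow> a (of_real s) i \<in> \<real>)" for t :: real and a
    have "\<exists>a. good t a" if "\<bar>t\<bar> < \<delta>" for t
    proof -
      have "cmod (of_real t) < \<delta>" using that by simp
      then obtain a where a: "\<forall>i. (\<lambda>s. a s i) holomorphic_on ?S"
        "\<forall>s\<in>?S. (\<forall>i. a s i = of_real (v $ i) + of_real t * quadratic_map (G s) (H s) (a s) i) \<and>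
          ((\<forall>i j k. G s i j k \<in> \<real>) \<and> (\<forall>i j. H s i j \<in> \<real>) \<and> (\<forall>i. of_real (v $ i) \<in> (\<real> :: complex set)) \<and> of_real t \<in> (\<real> :: complex set) \<longrightarrow>
            (\<forall>i. a s i \<in> \<real>))"
        using \<delta>(2) by blast
      have "a (of_real s) i \<in> \<real>" if "of_real s \<in> ?S" for s i
        using conjunct2[OF bspec[OF a(2) that]] realGH by (metis Reals_of_real)
      then show ?thesis unfolding good_def using a by blast
    qed
    then obtain a where "\<And>t. \<bar>t\<bar> < \<delta> \<Longrightarrow> good t (a t)" by metis
    then have a_hol: "\<And>t i. \<bar>t\<bar> < \<delta> \<Longrightarrow> (\<lambda>s. a t s i) holomorphic_on ?S"
      and a_fix: "\<And>t s i. \<bar>t\<bar> < \<delta> \<Longrightarrow> s \<in> ?S \<Longrightarrow>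
        a t s i = of_real (v $ i) + of_real t * quadratic_map (G s) (H s) (a t s) i"
      and a_real: "\<And>t s i. \<bar>t\<bar> < \<delta> \<Longrightarrow> of_real s \<in> ?S \<Longrightarrow> a t (of_real s) i \<in> \<real>"
      unfolding good_def by blast+
    define ar where "ar t s = (\<chi> i. Re (a t (of_real s) i))" for t s
    have ar: "of_real (ar t s $ i) = a t (of_real s) i" if "\<bar>t\<bar> < \<delta>" "of_real s \<in> ?S" for t s i
      using a_real[OF that] by (simp add: ar_def)
    have ar_fix: "ar t s = v + t *\<^sub>R eigen_map (Rs s) (Cs s) l (ar t s)"
      if "\<bar>t\<bar> < \<delta>" "of_real s \<in> ?S" for t s
    proof -
      have "complex_of_real (ar t s $ i) = of_real ((v + t *\<^sub>R eigen_map (Rs s) (Cs s) l (ar t s)) $ i)" for i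
        using a_fix[OF that, of i] by (simp add: real_map ar[OF that])
      then show ?thesis unfolding of_real_eq_iff vec_eq_iff by blast
    qed
    \<comment> \<open>The Boolean index selects a coordinate of (1, t): \<open>False\<close> for 1
      and \<open>True\<close> for \<open>t\<close>. Correspondingly \<open>pr c d\<close> packs a
      pair of functionals into one vector.\<close>
    let ?z = "\<lambda>t s. (\<chi> p. (if fst p then t else 1) * ar t s $ snd p) :: real^(bool \<times> 'n)"
    define pr where "pr c d = (\<chi> p. if fst p then d $ snd p else c $ snd p)" for c d :: "real^'n"
    have pr: "pr c d \<bullet> ?z t s = c \<bullet> ar t s + t * (d \<bullet> ar t s)" for c d t s
    proof -
      have "pr c d \<bullet> ?z t s = (\<Sum>(b, i)\<in>UNIV \<times> UNIV. pr c d $ (b, i) * ?z t s $ (b, i))"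
        by (simp add: inner_vec_def case_prod_unfold)
      also have "\<dots> = (\<Sum>b\<in>UNIV. \<Sum>i\<in>UNIV. pr c d $ (b, i) * ?z t s $ (b, i))"
        by (rule sum.cartesian_product[symmetric])
      also have "\<dots> = c \<bullet> ar t s + t * (d \<bullet> ar t s)"
        by (simp add: UNIV_bool pr_def inner_vec_def sum_distrib_left mult_ac)
      finally show ?thesis .
    qed
    have pr_0: "pr c d = 0 \<longleftrightarrow> c = 0 \<and> d = 0" for c d
      by (auto simp: pr_def vec_eq_iff split: if_splits)
    have pr_surj: "\<exists>c d. x = pr c d" for x
      by (intro exI[of _ "\<chi> i. x $ (False, i)"] exI[of _ "\<chi> i. x $ (True, i)"])
         (auto simp: pr_def vec_eq_iff)
    \<comment> \<open>At \<open>s = 1\<close> the solutions, seen through \<open>P'\<close>, satisfy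
      the cyclic recurrence for all real \<open>t\<close> in the interval, so their tensors
      span.\<close>
    obtain f where f: "\<And>j. f j \<in> (\<lambda>t. ?z t 1) ` {-\<delta><..<\<delta>}" "det (\<chi> r j. f j $ r) \<noteq> 0"
    proof (rule exists_det_nonzero)
      fix x assume *: "\<And>y. y \<in> (\<lambda>t. ?z t 1) ` {-\<delta><..<\<delta>} \<Longrightarrow> x \<bullet> y = 0"
      obtain c d where x: "x = pr c d" using pr_surj by blast
      have rel: "c \<bullet> ar t 1 + t * (d \<bullet> ar t 1) = 0" if "t \<in> {-\<delta><..<\<delta>}" for t
        using *[OF imageI[OF that]] by (simp only: x pr)
      have fix1: "ar t 1 = v + t *\<^sub>R eigen_map Q C' l (ar t 1)" if "t \<in> {-\<delta><..<\<delta>}" for t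
        using ar_fix[of t 1] that by (simp add: Rs_def Cs_def abs_less_iff)
      have tr: "f \<bullet> ar t 1 = (f v* P) \<bullet> (P' *v ar t 1)" for f t
        by (simp add: dot_lmul_matrix P(1))
      have "c v* P = 0 \<and> d v* P = 0"
      proof (rule cyclic_curve_spans[OF n_def _ e, of "{-\<delta><..<\<delta>}" "\<lambda>t. P' *v ar t 1"])
        show "n \<ge> 2" using assms(3) by (simp add: n_def)
        show "infinite {-\<delta><..<\<delta>}" using \<delta>(1) by simp
        show "(P' *v ar t 1) $ e 0 = 1" if "t \<in> {-\<delta><..<\<delta>}" for t
          by (rule at_1(1)[OF fix1[OF that]])
        show "(P' *v ar t 1) $ e (Suc m) = t * ((P' *v ar t 1) $ e (n - 1) * (P' *v ar t 1) $ e (Suc m)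
            + (P' *v ar t 1) $ e m)" if "t \<in> {-\<delta><..<\<delta>}" "Suc m < n" for t m
          by (rule at_1(2)[OF fix1[OF that(1)] that(2)])
        show "(c v* P) \<bullet> (P' *v ar t 1) + t * ((d v* P) \<bullet> (P' *v ar t 1)) = 0"
          if "t \<in> {-\<delta><..<\<delta>}" for t
          using rel[OF that] by (simp only: tr)
      qed
      moreover have "f = 0" if "f v* P = 0" for f
      proof -
        have "f \<bullet> x = 0" for x using dot_lmul_matrix[of f P "P' *v x"] by (simp add: that P(1))
        then show ?thesis by (metis inner_eq_zero_iff)
      qed
      ultimately show "x = 0" by (simp add: x pr_0)
    next
      fix f :: "bool \<times> 'n \<Rightarrow> real^(bool \<times> 'n)"
      assume "\<And>j. f j \<in> (\<lambda>t. ?z t 1) ` {-\<delta><..<\<delta>}" "det (\<chi> r j. f j $ r) \<noteq> 0"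
      then show thesis by (rule that[of f])
    qed
    have "\<exists>t. \<bar>t\<bar> < \<delta> \<and> f j = ?z t 1" for j using f(1)[of j] by (auto simp: abs_less_iff)
    then obtain \<tau> where \<tau>: "\<And>j. \<bar>\<tau> j\<bar> < \<delta>" "\<And>j. f j = ?z (\<tau> j) 1" by metis
    \<comment> \<open>The parameters \<open>\<tau> j\<close> found at \<open>s = 1\<close> are kept
      fixed; only \<open>s\<close> varies from here on.\<close>
    define A where "A s = (\<chi> r j. ?z (\<tau> j) s $ r)" for s
    have "\<forall>\<^sub>F s in at_right 0. det (A s) \<noteq> 0"
    proof (rule eventually_det_neq_0[where S = ?S and ?r0.0 = 1
          and M = "\<lambda>s r j. (if fst r then of_real (\<tau> j) else 1) * a (\<tau> j) s (snd r)"])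
      show "(\<lambda>s. (if fst r then of_real (\<tau> j) else 1) * a (\<tau> j) s (snd r)) holomorphic_on ?S" for r j
        by (intro holomorphic_intros a_hol \<tau>)
      show "(if fst r then of_real (\<tau> j) else 1) * a (\<tau> j) (of_real s) (snd r) = of_real (A s $ r $ j)"
        if "of_real s \<in> ?S" for s r j
        using ar[OF \<tau>(1) that] by (simp add: A_def)
      show "det (A 1) \<noteq> 0" using f(2) by (simp add: A_def \<tau>(2))
    qed auto
    moreover have "\<forall>\<^sub>F s in at_right (0::real). \<bar>s\<bar> < 2"
      by (auto simp: eventually_at_right_field intro!: exI[of _ 2])
    ultimately show "\<forall>\<^sub>F s in at_right 0. \<forall>c d.
      (\<forall>t a. a = v + t *\<^sub>R eigen_map ((1 - s) *\<^sub>R R + s *\<^sub>R Q) ((1 - s) *\<^sub>R C + s *\<^sub>R C') l a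
      \<longrightarrow> c \<bullet> a + t * (d \<bullet> a) = 0) \<longrightarrow> c = 0 \<and> d = 0"
    proof eventually_elim
      case (elim s)
      show ?case
      proof (intro allI impI, fold Rs_def Cs_def)
        fix c d assume *: "\<forall>t a. a = v + t *\<^sub>R eigen_map (Rs s) (Cs s) l a \<longrightarrow> c \<bullet> a + t * (d \<bullet> a) = 0"
        have s: "of_real s \<in> ?S" using elim(2) by simp
        have "pr c d \<bullet> ?z (\<tau> j) s = 0" for j
          unfolding pr using * ar_fix[OF \<tau>(1) s] by blast
        moreover have "(transpose (A s) *v pr c d) $ j = pr c d \<bullet> ?z (\<tau> j) s" for j
          by (simp add: A_def transpose_def matrix_vector_mult_def inner_vec_def mult_ac
              del: transpose_matrix_vector)
        ultimately have "transpose (A s) *v pr c d = 0" by (simp add: vec_eq_iff del: transpose_matrix_vector)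
        moreover have "det (transpose (A s)) \<noteq> 0" using elim(1) by simp
        ultimately have "pr c d = 0" using matrix_inv_inverse(1)[of "transpose (A s)" "pr c d"]
          by (simp del: transpose_matrix_vector)
        then show "c = 0 \<and> d = 0" by (simp add: pr_0)
      qed
    qed
  qed
qed

section \<open>The closures\<close>

lemma pencil_add_axis: "pencil (x + t *\<^sub>R axis k 1) Y = pencil x Y + t *\<^sub>R Y $ k"
proof -
  have "pencil (x + t *\<^sub>R axis k 1) Y =
      (\<Sum>j\<in>UNIV. x $ j *\<^sub>R Y $ j + (if j = k then t *\<^sub>R Y $ k else 0))"
    unfolding pencil_def by (rule sum.cong) (auto simp: axis_def scaleR_add_left)
  then show ?thesis by (simp add: sum.distrib pencil_def)
qed

text \<open>Every slice other than \<open>k0\<close> moves towards \<open>C'\<close>, while slice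
  \<open>k0\<close> is corrected so that the pencil at \<open>x\<close> keeps eigenvector
  \<open>v\<close> and eigenvalue \<open>\<mu>\<close>, with reduced resolvent \<open>Rs s\<close>.
  Eigenvectors along the lines \<open>x + t *\<^sub>R axis k 1\<close> then give enough
  tensors.\<close>

lemma reduced_resolvent_in_closure_Mset:
  fixes Y :: "real^'n^'n^'l"
  assumes card: "CARD('l) \<ge> 2" "CARD('n) \<ge> 2" and x: "x \<noteq> 0" and v: "norm v = 1"
    and red: "reduced_resolvent (pencil x Y - \<mu> *\<^sub>R mat 1) v l R"
  shows "Y \<in> closure Mset"
proof -
  define N where "N = pencil x Y - \<mu> *\<^sub>R mat 1"
  have red: "N *v v = 0" "l \<bullet> v = 1" "R *v v = 0" "\<And>y. l \<bullet> (R *v y) = 0"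
    "\<And>y. N *v (R *v y) = y - (l \<bullet> y) *\<^sub>R v"
    using red unfolding reduced_resolvent_def N_def by auto
  obtain k0 where k0: "x $ k0 \<noteq> 0" using x by (auto simp: vec_eq_iff)
  have "UNIV \<noteq> {k0}"
  proof
    assume "UNIV = {k0}"
    then have "CARD('l) = card {k0}" by simp
    then show False using card(1) by simp
  qed
  then obtain k1 where k1: "k1 \<noteq> k0" by blast
  obtain C' where C': "\<And>R C. \<forall>\<^sub>F s in at_right 0. \<forall>c d.
    (\<forall>t a. a = v + t *\<^sub>R eigen_map ((1 - s) *\<^sub>R R + s *\<^sub>R (mat 1 - outer v l)) ((1 - s) *\<^sub>R C + s *\<^sub>R C') l a
      \<longrightarrow> c \<bullet> a + t * (d \<bullet> a) = 0) \<longrightarrow> c = 0 \<and> d = 0"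
    using generic_eigenvector_span[OF v red(2) card(2)] by blast
  define Q where "Q = mat 1 - outer v l"
  have Q: "Q *v y = y - (l \<bullet> y) *\<^sub>R v" for y
    by (simp add: Q_def matrix_vector_mult_diff_rdistrib)
  define Rs where "Rs s = (1 - s) *\<^sub>R R + s *\<^sub>R Q" for s
  have Rs: "Rs s *v v = 0" "l \<bullet> (Rs s *v y) = 0" for s y
    by (simp_all add: Rs_def matrix_vector_mult_add_rdistrib scaleR_mat_mult red Q
        inner_add_right inner_diff_right)
  \<comment> \<open>The inverse of \<open>N + outer v l\<close> is \<open>R + outer v l\<close>.
    Inverting this relation at \<open>Rs s\<close> produces the matrix \<open>Ns s\<close> whose
    reduced resolvent is the prescribed one.\<close>
  define Ts where "Ts s = Rs s + outer v l" for s
  have Ts: "Ts s *v y = Rs s *v y + (l \<bullet> y) *\<^sub>R v" for s y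
    by (simp add: Ts_def matrix_vector_mult_add_rdistrib)
  define Ns where "Ns s = matrix_inv (Ts s) - outer v l" for s
  have Ns_red: "reduced_resolvent (Ns s) v l (Rs s)" if "det (Ts s) \<noteq> 0" for s
  proof -
    note inv = matrix_inv_inverse(1)[OF that]
    have Ns: "Ns s *v y = matrix_inv (Ts s) *v y - (l \<bullet> y) *\<^sub>R v" for y
      by (simp add: Ns_def matrix_vector_mult_diff_rdistrib)
    have v: "matrix_inv (Ts s) *v v = v" using inv[of v] by (simp add: Ts Rs red)
    have "Ns s *v (Rs s *v y) = y - (l \<bullet> y) *\<^sub>R v" for y
    proof -
      have "Rs s *v y = Ts s *v y - (l \<bullet> y) *\<^sub>R v" by (simp add: Ts)
      then have "matrix_inv (Ts s) *v (Rs s *v y) = y - (l \<bullet> y) *\<^sub>R v"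
        by (simp add: matrix_vector_mult_diff_distrib matrix_vector_mult_scaleR inv v)
      then show ?thesis by (simp add: Ns Rs)
    qed
    then show ?thesis by (simp add: reduced_resolvent_def Ns v red Rs)
  qed
  have inv0: "(N + outer v l) *v (Ts 0 *v y) = y" for y
    by (simp add: Ts Rs_def matrix_vector_mult_add_rdistrib matrix_vector_right_distrib
        matrix_vector_mult_scaleR red inner_add_right)
  have det0: "det (Ts 0) \<noteq> 0"
    by (rule det_neq_0_kernelI) (metis inv0 matrix_vector_mult_0_right)
  have "matrix_inv (Ts 0) = N + outer v l"
    unfolding matrix_eq using inv0 matrix_inv_inverse(2)[OF det0] by metis
  then have N0: "Ns 0 = N" by (simp add: Ns_def)
  have Ts_lim: "(Ts \<longlongrightarrow> Ts 0) (at_right 0)"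
    unfolding Ts_def Rs_def by (auto intro!: tendsto_eq_intros)
  have det: "\<forall>\<^sub>F s in at_right 0. det (Ts s) \<noteq> 0"
    using tendsto_imp_eventually_ne[OF tendsto_det[OF Ts_lim] det0] .
  have Ns_lim: "(Ns \<longlongrightarrow> N) (at_right 0)"
    unfolding N0[symmetric] Ns_def by (intro tendsto_intros tendsto_matrix_inv Ts_lim det0)
  define Z where "Z s = (\<chi> k. (1 - s) *\<^sub>R Y $ k + s *\<^sub>R C')" for s
  define Ys where "Ys s = adjust k0 x (Z s) (Ns s + \<mu> *\<^sub>R mat 1)" for s
  have "(Z \<longlongrightarrow> Z 0) (at_right 0)"
    unfolding Z_def by (intro tendsto_vec_lambda) (auto intro!: tendsto_eq_intros)
  moreover have "Z 0 = Y" by (simp add: Z_def vec_eq_iff)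
  ultimately have "(Ys \<longlongrightarrow> adjust k0 x Y (N + \<mu> *\<^sub>R mat 1)) (at_right 0)"
    unfolding Ys_def by (intro tendsto_adjust tendsto_intros Ns_lim) simp
  then have lim: "(Ys \<longlongrightarrow> Y) (at_right 0)" by (simp add: N_def)
  have "\<forall>\<^sub>F s in at_right 0. \<forall>k\<in>UNIV. \<forall>c d.
    (\<forall>t a. a = v + t *\<^sub>R eigen_map (Rs s) ((1 - s) *\<^sub>R Y $ k + s *\<^sub>R C') l a
      \<longrightarrow> c \<bullet> a + t * (d \<bullet> a) = 0) \<longrightarrow> c = 0 \<and> d = 0"
    unfolding Rs_def Q_def by (intro eventually_ball_finite ballI C') auto
  with det have "\<forall>\<^sub>F s in at_right 0. Ys s \<in> Mset"
  proof eventually_elim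
    case (elim s)
    have Y0: "pencil x (Ys s) = Ns s + \<mu> *\<^sub>R mat 1"
      by (simp add: Ys_def pencil_adjust[OF k0])
    show ?case
    proof (rule Mset_criterion)
      fix c :: "real^'n^'l"
      assume c: "\<And>x a \<mu>. pencil x (Ys s) *v a = \<mu> *\<^sub>R a \<Longrightarrow> (\<Sum>k\<in>UNIV. x $ k *\<^sub>R c $ k) \<bullet> a = 0"
      let ?cx = "\<Sum>k\<in>UNIV. x $ k *\<^sub>R c $ k"
      \<comment> \<open>Along the line in direction \<open>k\<close>, the functional pairs with the
        eigenvector as \<open>?cx \<bullet> a + t * (c $ k \<bullet> a)\<close>, the relation
        excluded by the choice of \<open>C'\<close>.\<close>
      have *: "?cx = 0 \<and> c $ k = 0" if k: "k \<noteq> k0" for k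
      proof -
        define C where "C = (1 - s) *\<^sub>R Y $ k + s *\<^sub>R C'"
        have Yk: "Ys s $ k = C" by (simp add: Ys_def adjust_nth[OF k] Z_def C_def)
        have "?cx \<bullet> a + t * (c $ k \<bullet> a) = 0" if a: "a = v + t *\<^sub>R eigen_map (Rs s) C l a" for t a
        proof -
          have "(Ns s + t *\<^sub>R C) *v a = (t * (l \<bullet> (C *v a))) *\<^sub>R a"
            by (rule eigen_map_fixed_point[OF Ns_red[OF elim(1)] a])
          then have "pencil (x + t *\<^sub>R axis k 1) (Ys s) *v a = (\<mu> + t * (l \<bullet> (C *v a))) *\<^sub>R a"
            by (simp add: pencil_add_axis Y0 Yk matrix_vector_mult_add_rdistrib scaleR_mat_mult
                scaleR_add_left add_ac)
          then have "(\<Sum>j\<in>UNIV. (x + t *\<^sub>R axis k 1) $ j *\<^sub>R c $ j) \<bullet> a = 0"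
            by (rule c)
          moreover have "(\<Sum>j\<in>UNIV. (x + t *\<^sub>R axis k 1) $ j *\<^sub>R c $ j) = ?cx + t *\<^sub>R c $ k"
          proof -
            have "(\<Sum>j\<in>UNIV. (x + t *\<^sub>R axis k 1) $ j *\<^sub>R c $ j) =
                (\<Sum>j\<in>UNIV. x $ j *\<^sub>R c $ j + (if j = k then t *\<^sub>R c $ k else 0))"
              by (rule sum.cong) (auto simp: axis_def scaleR_add_left)
            then show ?thesis by (simp add: sum.distrib)
          qed
          ultimately show ?thesis by (simp add: inner_add_left)
        qed
        then show ?thesis using elim(2) unfolding C_def by blast
      qed
      \<comment> \<open>Only the slice \<open>k0\<close> is left; \<open>?cx = 0\<close>, known
        through \<open>k1\<close>, and \<open>x $ k0 \<noteq> 0\<close> remove it.\<close>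
      have "?cx = (\<Sum>k\<in>UNIV. if k = k0 then x $ k0 *\<^sub>R c $ k0 else 0)"
        by (rule sum.cong) (auto simp: *)
      then have "x $ k0 *\<^sub>R c $ k0 = 0" using *[OF k1] by simp
      then have "c $ k = 0" for k using k0 * by (cases "k = k0") auto
      then show "c = 0" by (simp add: vec_eq_iff)
    qed
  qed
  then show ?thesis using tendsto_in_closure[OF lim] by (simp add: trivial_limit_at_right_real)
qed

lemma eigenvector_in_closure_Mset:
  fixes Y :: "real^'n^'n^'l"
  assumes card: "CARD('l) \<ge> 2" "CARD('n) \<ge> 2" and x: "x \<noteq> 0"
    and v: "v \<noteq> 0" "pencil x Y *v v = \<mu> *\<^sub>R v"
  shows "Y \<in> closure Mset"
proof -
  define u where "u = v /\<^sub>R norm v"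
  let ?T = "{N. \<exists>l R. reduced_resolvent N u l R}"
  have u: "norm u = 1" using v by (simp add: u_def)
  have "(pencil x Y - \<mu> *\<^sub>R mat 1) *v u = 0"
    using v by (simp add: u_def matrix_vector_mult_scaleR matrix_vector_mult_diff_rdistrib scaleR_mat_mult)
  then have "pencil x Y - \<mu> *\<^sub>R mat 1 \<in> closure ?T"
    using u by (rule singular_in_closure_reduced_resolvent)
  then have "\<mu> *\<^sub>R mat 1 + (pencil x Y - \<mu> *\<^sub>R mat 1) \<in> closure ((+) (\<mu> *\<^sub>R mat 1) ` ?T)"
    unfolding closure_translation by blast
  then have "pencil x Y \<in> closure ((+) (\<mu> *\<^sub>R mat 1) ` ?T)" by simp
  \<comment> \<open>Two successive perturbations: first to a simple eigenvalue, then into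
    \<open>Mset\<close>.\<close>
  then have "Y \<in> closure (closure Mset)"
  proof (rule pencil_closure[OF x])
    fix Y' :: "real^'n^'n^'l"
    assume "pencil x Y' \<in> (+) (\<mu> *\<^sub>R mat 1) ` ?T"
    then obtain N l R where N: "pencil x Y' = \<mu> *\<^sub>R mat 1 + N" "reduced_resolvent N u l R" by blast
    then have "reduced_resolvent (pencil x Y' - \<mu> *\<^sub>R mat 1) u l R" by simp
    then show "Y' \<in> closure Mset" by (rule reduced_resolvent_in_closure_Mset[OF card x u])
  qed
  then show ?thesis by simp
qed

lemma eigenvector_in_closure_Cset:
  fixes Y :: "real^'n^'n^'l"
  assumes x: "x \<noteq> 0" and v: "v \<noteq> 0" "pencil x Y *v v = \<mu> *\<^sub>R v"
  shows "Y \<in> closure Cset"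
proof -
  let ?T = "{W :: real^'n^'n. det W < 0}"
  have "(pencil x Y - \<mu> *\<^sub>R mat 1) *v v = 0"
    using v by (simp add: matrix_vector_mult_diff_rdistrib scaleR_mat_mult)
  then have "pencil x Y - \<mu> *\<^sub>R mat 1 \<in> closure ?T"
    using v(1) by (rule singular_in_closure_det_neg)
  then have "\<mu> *\<^sub>R mat 1 + (pencil x Y - \<mu> *\<^sub>R mat 1) \<in> closure ((+) (\<mu> *\<^sub>R mat 1) ` ?T)"
    unfolding closure_translation by blast
  then have "pencil x Y \<in> closure ((+) (\<mu> *\<^sub>R mat 1) ` ?T)" by simp
  then show ?thesis
  proof (rule pencil_closure[OF x])
    fix Y' :: "real^'n^'n^'l"
    assume "pencil x Y' \<in> (+) (\<mu> *\<^sub>R mat 1) ` ?T"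
    then obtain W where W: "pencil x Y' = \<mu> *\<^sub>R mat 1 + W" "det W < 0" by blast
    then have "det (Mmat x \<mu> Y') < 0" by (simp add: Mmat_pencil)
    then show "Y' \<in> Cset" unfolding Cset_def by blast
  qed
qed

text \<open>Along the shifts by \<rho> the determinant goes from a negative value to a positive one
  for some large \<rho>, so it vanishes in between and gives a real eigenvalue.\<close>

lemma Cset_eigenvector:
  fixes Y :: "real^'n^'n^'l"
  assumes "Y \<in> Cset"
  obtains x v \<mu> where "x \<noteq> 0" "v \<noteq> 0" "pencil x Y *v v = \<mu> *\<^sub>R v"
proof -
  obtain x0 \<mu>0 where neg: "det (pencil x0 Y - \<mu>0 *\<^sub>R mat 1) < 0"
    using assms by (auto simp: Cset_def Mmat_pencil)
  \<comment> \<open>The given coefficient vector may be 0, for instance when n is odd; a small move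
    in one coordinate makes it nonzero and keeps the determinant negative.\<close>
  obtain k :: 'l where True by blast
  have "((\<lambda>t. det (pencil (x0 + t *\<^sub>R axis k 1) Y - \<mu>0 *\<^sub>R mat 1)) \<longlongrightarrow>
      det (pencil x0 Y + 0 *\<^sub>R Y $ k - \<mu>0 *\<^sub>R mat 1)) (at 0)"
    unfolding pencil_add_axis by (intro tendsto_det tendsto_intros)
  then have "\<forall>\<^sub>F t in at 0. det (pencil (x0 + t *\<^sub>R axis k 1) Y - \<mu>0 *\<^sub>R mat 1) < 0"
    by (rule order_tendstoD) (simp add: neg)
  moreover have "\<forall>\<^sub>F t in at 0. t \<noteq> - x0 $ k"
    by (cases "x0 $ k = 0") (auto intro: eventually_neq_at_within tendsto_imp_eventually_ne[OF tendsto_ident_at])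
  ultimately have "\<forall>\<^sub>F t in at 0. det (pencil (x0 + t *\<^sub>R axis k 1) Y - \<mu>0 *\<^sub>R mat 1) < 0 \<and> t \<noteq> - x0 $ k"
    by (rule eventually_conj)
  then obtain t where t: "det (pencil (x0 + t *\<^sub>R axis k 1) Y - \<mu>0 *\<^sub>R mat 1) < 0" "t \<noteq> - x0 $ k"
    using eventually_happens'[of "at 0 :: real filter"] by auto
  define x where "x = x0 + t *\<^sub>R axis k 1"
  have "x $ k \<noteq> 0" using t(2) by (simp add: x_def axis_def)
  then have x: "x \<noteq> 0" by auto
  let ?f = "\<lambda>\<rho>. det (pencil x Y + \<rho> *\<^sub>R mat 1)"
  obtain \<rho> where \<rho>: "\<rho> > - \<mu>0" "?f \<rho> > 0" using det_shift_pos by metis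
  have "continuous_on {- \<mu>0..\<rho>} ?f"
    unfolding continuous_on_def by (intro ballI tendsto_det tendsto_intros)
  moreover have "?f (- \<mu>0) < 0" using t(1) by (simp add: x_def)
  ultimately obtain r where r: "?f r = 0"
    using IVT'[of ?f "- \<mu>0" 0 \<rho>] \<rho> by force
  then obtain v where v: "v \<noteq> 0" "(pencil x Y + r *\<^sub>R mat 1) *v v = 0"
    using det_neq_0_kernelI by blast
  then have "pencil x Y *v v = (- r) *\<^sub>R v"
    by (simp add: matrix_vector_mult_add_rdistrib scaleR_mat_mult eq_neg_iff_add_eq_0)
  then show thesis using that x v(1) by blast
qed

lemma Sset_eigenvector:
  fixes Y :: "real^'n^'n^'l"
  assumes "Y \<in> Sset"
  obtains x v \<mu> where "x \<noteq> 0" "v \<noteq> 0" "pencil x Y *v v = \<mu> *\<^sub>R v"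
proof -
  have "dim (Vset Y) \<noteq> 0" using assms by (simp add: Sset_def)
  then obtain v where v: "v \<in> Vset Y" "v \<noteq> 0" by (auto simp: dim_eq_0)
  then obtain x \<mu> where *: "x \<noteq> 0 \<or> \<mu> \<noteq> 0" "pencil x Y *v v = \<mu> *\<^sub>R v"
    by (auto simp: Vset_def pencil_def)
  have "x \<noteq> 0"
  proof
    assume "x = 0"
    then show False using * v(2) by (simp add: pencil_def)
  qed
  then show thesis using that v(2) * by blast
qed

text \<open>Nonsingularity makes every column nonzero, so each \<open>x j\<close> is nonzero and
  \<open>a j\<close> lies in \<open>Vset Y\<close>. A vector \<open>c\<close> orthogonal to all
  \<open>a j\<close> would yield a nonzero vector orthogonal to every column.\<close>

lemma Mset_subset_Sset: "Mset \<subseteq> (Sset :: (real^'n^'n^'l) set)"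
proof
  fix Y :: "real^'n^'n^'l"
  assume "Y \<in> Mset"
  then obtain x \<mu> and a :: "'l \<times> 'n \<Rightarrow> real^'n" where *: "\<And>j. pencil (x j) Y *v a j = \<mu> j *\<^sub>R a j"
    and det: "det ((\<chi> r j. (a j $ snd r) * (x j $ fst r)) :: real^('l \<times> 'n)^('l \<times> 'n)) \<noteq> 0"
    by (auto simp: Mset_def Mmat_mult_eq_0_iff)
  let ?A = "(\<chi> r j. (a j $ snd r) * (x j $ fst r)) :: real^('l \<times> 'n)^('l \<times> 'n)"
  have col: "x j \<noteq> 0" for j
  proof
    assume "x j = 0"
    then have "column j ?A = 0" by (simp add: column_def vec_eq_iff)
    then show False using det det_zero_column by blast
  qed
  have a: "a j \<in> Vset Y" for j
    using *[of j] col[of j] unfolding Vset_def pencil_def by blast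
  have "span (Vset Y) = UNIV"
  proof (rule ccontr)
    assume "span (Vset Y) \<noteq> UNIV"
    then obtain c where c: "c \<noteq> 0" "span (Vset Y) \<subseteq> {y. c \<bullet> y = 0}"
      using span_not_univ_subset_hyperplane by metis
    obtain k :: 'l where True by blast
    \<comment> \<open>The tensor of the \<open>k\<close>-th unit vector with \<open>c\<close>; it
      pairs with column \<open>j\<close> to \<open>x j $ k * (c \<bullet> a j)\<close>.\<close>
    let ?z = "(\<chi> r. if fst r = k then c $ snd r else 0) :: real^('l \<times> 'n)"
    have "(transpose ?A *v ?z) $ j = 0" for j
    proof -
      have "(transpose ?A *v ?z) $ j = (\<Sum>(q, i)\<in>UNIV \<times> UNIV. a j $ i * x j $ q * (if q = k then c $ i else 0))"
        by (simp add: transpose_def matrix_vector_mult_def case_prod_unfold del: transpose_matrix_vector)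
      also have "\<dots> = (\<Sum>q\<in>UNIV. \<Sum>i\<in>UNIV. a j $ i * x j $ q * (if q = k then c $ i else 0))"
        by (rule sum.cartesian_product[symmetric])
      also have "\<dots> = (\<Sum>q\<in>UNIV. if q = k then x j $ k * (c \<bullet> a j) else 0)"
        by (rule sum.cong) (auto simp: inner_vec_def sum_distrib_left mult_ac)
      also have "\<dots> = 0" using c(2) a[of j] span_base by auto
      finally show ?thesis .
    qed
    then have "transpose ?A *v ?z = 0" by (simp add: vec_eq_iff del: transpose_matrix_vector)
    moreover have "det (transpose ?A) \<noteq> 0" using det by simp
    ultimately have "?z = 0" using matrix_inv_inverse(1)[of "transpose ?A" ?z]
      by (simp del: transpose_matrix_vector)
    have "c $ i = 0" for i
    proof -
      have "c $ i = ?z $ (k, i)" by simp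
      then show ?thesis by (simp only: \<open>?z = 0\<close> zero_index)
    qed
    then show False using c(1) by (simp add: vec_eq_iff)
  qed
  then have "dim (span (Vset Y)) = CARD('n)" by (simp only: dim_UNIV DIM_cart DIM_real mult_1_right)
  then show "Y \<in> Sset" by (simp only: Sset_def mem_Collect_eq)
qed

theorem mainTheorem20:
  assumes "CARD('l::finite) \<ge> 2" and "CARD('l) + 1 \<le> CARD('n::finite)"
  shows "closure (Sset :: (real^'n^'n^'l) set) = closure (Mset :: (real^'n^'n^'l) set)
       \<and> closure (Mset :: (real^'n^'n^'l) set) = closure (Cset :: (real^'n^'n^'l) set)"
proof -
  have card: "CARD('l) \<ge> 2" "CARD('n) \<ge> 2" using assms by simp_all
  let ?S = "Sset :: (real^'n^'n^'l) set" and ?M = "Mset :: (real^'n^'n^'l) set"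
    and ?C = "Cset :: (real^'n^'n^'l) set"
  \<comment> \<open>Three inclusions arranged in a cycle, each of one set in the closure of the
    next, make all closures equal.\<close>
  have "?S \<subseteq> closure ?C"
    by (meson Sset_eigenvector eigenvector_in_closure_Cset subsetI)
  moreover have "?C \<subseteq> closure ?M"
    by (meson Cset_eigenvector eigenvector_in_closure_Mset[OF card] subsetI)
  moreover have "?M \<subseteq> closure ?S" using Mset_subset_Sset closure_subset by blast
  ultimately show ?thesis by (meson closure_minimal closed_closure subset_antisym subset_trans)
qed

end
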